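(* Let $r\in(1,2]$, $L>0$ and $\sigma>0$, and consider the regression model $y_i=f(x_i)+\sigma\epsilon_i$, $i=1,\dots,n$, with $x_i=i/n$ and $\epsilon_1,\dots,\epsilon_n$ independent standard normal. Let $\mathcal C_H(r,L)$ be the Hölder class of convex functions on $[0,1]$ defined in the context. Then there exists a positive constant $C_0$ (not depending on $n$) such that $$\inf_{\hat f}\ \sup_{f\in\mathcal C_H(r,L)}\mathbb E\big(\|\hat f-f\|_\infty\big)\ \asymp\ C_0\Big(\frac{\log n}{n}\Big)^{\frac{r}{2r+1}},$$ where the infimum is over all estimators $\hat f$ of $f$ based on $(y_1,\dots,y_n)$.
   Context: $\mathcal C_H(r,L):=\mathcal C\cap H^r_L$, where $\mathcal C$ is the collection of continuous convex functions $f:[0,1]\to\mathbb R$ that are differentiable, i.e. $(f'(x_1)-f'(x_2))(x_1-x_2)\ge 0$ for all $x_1,x_2\in[0,1]$; and $H^r_L$ is the Hölder class of $f:[0,1]\to\mathbb R$ with $|f'(x_1)-f'(x_2)|\le L|x_1-x_2|^{\gamma}$ for all $x_1,x_2\in[0,1]$, where $\gamma:=r-1\in(0,1]$. $\|g\|_\infty=\sup_{x\in[0,1]}|g(x)|$. An estimator $\hat f$ is a (measurable) function of the data $(y_1,\dots,y_n)$ with values in functions on $[0,1]$; it may depend on $n,r,L,\sigma$ but not on $f$. The expectation is taken under the model with true function $f$. For sequences, $a_n\asymp b_n$ means that $a_n/b_n$ is bounded from below and above by two positive constants for all $n$ sufficiently large. *)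

theory Defs
  imports "HOL-Probability.Probability"
begin

text \<open>
  Functions on the unit interval are represented by functions on the reals, of which only the
  values on \<open>{0..1}\<close> are ever used.  Derivatives are taken relative to \<open>{0..1}\<close>,
  hence they are one-sided at the two endpoints.
\<close>

definition deriv01 :: "(real \<Rightarrow> real) \<Rightarrow> real \<Rightarrow> real" where
  "deriv01 f x = vector_derivative f (at x within {0..1})"

definition convex_class :: "(real \<Rightarrow> real) set" where
  "convex_class = {f. continuous_on {0..1} f \<and> convex_on {0..1} f \<and> f differentiable_on {0..1} \<and>
     (\<forall>x1\<in>{0..1}. \<forall>x2\<in>{0..1}. (deriv01 f x1 - deriv01 f x2) * (x1 - x2) \<ge> 0)}"

definition holder_class :: "real \<Rightarrow> real \<Rightarrow> (real \<Rightarrow> real) set" where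
  "holder_class r L = {f. f differentiable_on {0..1} \<and>
     (\<forall>x1\<in>{0..1}. \<forall>x2\<in>{0..1}. \<bar>deriv01 f x1 - deriv01 f x2\<bar> \<le> L * \<bar>x1 - x2\<bar> powr (r - 1))}"

definition convex_holder_class :: "real \<Rightarrow> real \<Rightarrow> (real \<Rightarrow> real) set" where
  "convex_holder_class r L = convex_class \<inter> holder_class r L"

text \<open>
  The supremum norm takes extended values, because nothing prevents an estimate from being
  unbounded on \<open>{0..1}\<close>.
\<close>

definition sup_norm01 :: "(real \<Rightarrow> real) \<Rightarrow> ennreal" where
  "sup_norm01 g = (SUP x\<in>{0..1}. ennreal \<bar>g x\<bar>)"

abbreviation data_space :: "nat \<Rightarrow> (nat \<Rightarrow> real) measure" where
  "data_space n \<equiv> (\<Pi>\<^sub>M i\<in>{1..n}. borel)"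

text \<open>The joint law of the observations \<open>y i = f (i / n) + \<sigma> * \<epsilon> i\<close> for \<open>i \<in> {1..n}\<close>.\<close>

definition data_law :: "nat \<Rightarrow> real \<Rightarrow> (real \<Rightarrow> real) \<Rightarrow> (nat \<Rightarrow> real) measure" where
  "data_law n \<sigma> f =
     distr (\<Pi>\<^sub>M i\<in>{1..n}. std_normal_distribution) (data_space n)
       (\<lambda>\<epsilon>. \<lambda>i\<in>{1..n}. f (real i / real n) + \<sigma> * \<epsilon> i)"

text \<open>
  An estimator must be measurable at each point of \<open>{0..1}\<close>.  Since the supremum over an
  uncountable set need not preserve measurability, the loss is also required to be a random
  variable for every possible true function, so that its expectation is defined.
\<close>

definition estimators :: "nat \<Rightarrow> (real \<Rightarrow> real) set \<Rightarrow> ((nat \<Rightarrow> real) \<Rightarrow> real \<Rightarrow> real) set" where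
  "estimators n F = {fhat.
     (\<forall>x\<in>{0..1}. (\<lambda>y. fhat y x) \<in> borel_measurable (data_space n)) \<and>
     (\<forall>f\<in>F. (\<lambda>y. sup_norm01 (\<lambda>x. fhat y x - f x)) \<in> borel_measurable (data_space n))}"

definition sup_risk ::
  "nat \<Rightarrow> real \<Rightarrow> ((nat \<Rightarrow> real) \<Rightarrow> real \<Rightarrow> real) \<Rightarrow> (real \<Rightarrow> real) \<Rightarrow> ennreal" where
  "sup_risk n \<sigma> fhat f = (\<integral>\<^sup>+ y. sup_norm01 (\<lambda>x. fhat y x - f x) \<partial>data_law n \<sigma> f)"

definition minimax_risk :: "real \<Rightarrow> real \<Rightarrow> real \<Rightarrow> nat \<Rightarrow> ennreal" where
  "minimax_risk r L \<sigma> n =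
     (INF fhat\<in>estimators n (convex_holder_class r L).
        SUP f\<in>convex_holder_class r L. sup_risk n \<sigma> fhat f)"

definition same_order :: "(nat \<Rightarrow> ennreal) \<Rightarrow> (nat \<Rightarrow> ennreal) \<Rightarrow> bool" (infix "\<asymp>" 50) where
  "a \<asymp> b \<longleftrightarrow> (\<exists>c C :: real. 0 < c \<and> 0 < C \<and>
     (\<forall>\<^sub>F n in sequentially. ennreal c \<le> a n / b n \<and> a n / b n \<le> ennreal C))"

end

theory Submission
  imports Defs "HOL-Real_Asymp.Real_Asymp"
begin

text \<open>
  Put \<open>h = (ln n / n) powr (1 / (2 * r + 1))\<close>, so that \<open>h powr r\<close> is the claimed rate.

  Upper bound: average the observations over consecutive blocks of length about \<open>h\<close> and
  interpolate the averages affinely.  The bias is \<open>O(h powr r)\<close> by Taylor's theorem, and the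
  maximum of the polynomially many centred Gaussian averages, each of variance about
  \<open>\<sigma>\<^sup>2 / (n * h)\<close>, has expectation \<open>O(sqrt (ln n / (n * h)))\<close>, again of order \<open>h powr r\<close>.

  Lower bound: a convex function whose slope climbs by a multiple of \<open>h powr (r - 1)\<close> on each of
  \<open>M\<close> intervals of length \<open>h\<close>, where \<open>M\<close> is about \<open>h powr (1 - r)\<close>, lies in the class, and so
  does its modification by a bump of height of order \<open>h powr r\<close> on any one of the intervals.  The
  likelihood ratios of the modified functions have second moment at most a small power of \<open>n\<close>,
  hence small compared with \<open>M\<close>, so no estimator can locate the bump.
\<close>

subsection \<open>Gaussian shifts and a lower bound for the risk\<close>

lemma nn_integral_exp_std_normal:
  "(\<integral>\<^sup>+ x. ennreal (exp (a * x)) \<partial>std_normal_distribution) = ennreal (exp (a\<^sup>2 / 2))"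
proof -
  have eq: "std_normal_density x * exp (a * x) = exp (a\<^sup>2 / 2) * normal_density a 1 x" for x
    by (simp add: normal_density_def exp_add[symmetric] power2_eq_square field_simps)
  have "(\<integral>\<^sup>+ x. ennreal (exp (a * x)) \<partial>std_normal_distribution)
      = (\<integral>\<^sup>+ x. ennreal (exp (a\<^sup>2 / 2)) * ennreal (normal_density a 1 x) \<partial>lborel)"
    by (subst nn_integral_density) (auto simp: ennreal_mult'[symmetric] eq)
  also have "\<dots> = ennreal (exp (a\<^sup>2 / 2))"
    by (subst nn_integral_cmult) (auto simp: nn_integral_eq_integral)
  finally show ?thesis .
qed

interpretation std_normal: prob_space std_normal_distribution
  by (rule prob_space_normal_density) simp

interpretation std_normal_product: product_prob_space "\<lambda>_ :: nat. std_normal_distribution" UNIV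
  by standard

lemma prob_space_std_normal_PiM: "prob_space (\<Pi>\<^sub>M i\<in>I. std_normal_distribution)"
  by (intro prob_space_PiM std_normal.prob_space_axioms)

lemma nn_integral_exp_linear_std_normal:
  fixes I :: "nat set"
  assumes "finite I"
  shows "(\<integral>\<^sup>+ \<epsilon>. ennreal (exp (\<Sum>i\<in>I. a i * \<epsilon> i)) \<partial>(\<Pi>\<^sub>M i\<in>I. std_normal_distribution))
    = ennreal (exp ((\<Sum>i\<in>I. (a i)\<^sup>2) / 2))"
proof -
  have "(\<integral>\<^sup>+ \<epsilon>. ennreal (exp (\<Sum>i\<in>I. a i * \<epsilon> i)) \<partial>(\<Pi>\<^sub>M i\<in>I. std_normal_distribution))
      = (\<integral>\<^sup>+ \<epsilon>. (\<Prod>i\<in>I. ennreal (exp (a i * \<epsilon> i))) \<partial>(\<Pi>\<^sub>M i\<in>I. std_normal_distribution))"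
    by (simp add: exp_sum assms prod_ennreal)
  also have "\<dots> = (\<Prod>i\<in>I. ennreal (exp ((a i)\<^sup>2 / 2)))"
    by (subst std_normal_product.product_nn_integral_prod)
       (auto simp: assms nn_integral_exp_std_normal)
  also have "\<dots> = ennreal (exp ((\<Sum>i\<in>I. (a i)\<^sup>2) / 2))"
    by (simp add: exp_sum assms prod_ennreal sum_divide_distrib)
  finally show ?thesis .
qed

text \<open>The one-dimensional Cameron-Martin formula: translating Lebesgue measure moves the shift
  into the density, and the exponential is the quotient of the two normal densities.\<close>

lemma std_normal_shift:
  assumes "A \<in> sets borel"
  shows "emeasure std_normal_distribution {x. x + \<theta> \<in> A}
    = (\<integral>\<^sup>+ x. ennreal (exp (\<theta> * x - \<theta>\<^sup>2 / 2)) * indicator A x \<partial>std_normal_distribution)"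
proof -
  have eq: "std_normal_density (x - \<theta>) = std_normal_density x * exp (\<theta> * x - \<theta>\<^sup>2 / 2)" for x
    by (simp add: normal_density_def exp_add[symmetric] power2_eq_square field_simps)
  have [measurable]: "A \<in> sets borel" by fact
  have "emeasure std_normal_distribution {x. x + \<theta> \<in> A}
      = (\<integral>\<^sup>+ x. ennreal (std_normal_density x) * indicator A (x + \<theta>) \<partial>lborel)"
    by (subst emeasure_density) (auto intro!: nn_integral_cong split: split_indicator)
  also have "\<dots> = (\<integral>\<^sup>+ x. ennreal (std_normal_density (x - \<theta>)) * indicator A x \<partial>lborel)"
    using nn_integral_real_affine[of "\<lambda>x. ennreal (std_normal_density (x - \<theta>)) * indicator A x" 1 \<theta>]
    by (simp add: add.commute)
  also have "\<dots> = (\<integral>\<^sup>+ x. ennreal (exp (\<theta> * x - \<theta>\<^sup>2 / 2)) * indicator A x \<partial>std_normal_distribution)"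
    by (subst nn_integral_density) (auto simp: eq ennreal_mult' mult_ac)
  finally show ?thesis .
qed

text \<open>The product form of the Cameron-Martin formula. Both sides are identified with the
  product of the shifted laws by comparison on boxes, where the integral factorises.\<close>

lemma std_normal_PiM_shift:
  fixes I :: "nat set"
  assumes "finite I"
  shows "distr (\<Pi>\<^sub>M i\<in>I. std_normal_distribution) (\<Pi>\<^sub>M i\<in>I. std_normal_distribution)
      (\<lambda>\<epsilon>. \<lambda>i\<in>I. \<epsilon> i + \<theta> i)
    = density (\<Pi>\<^sub>M i\<in>I. std_normal_distribution)
        (\<lambda>\<epsilon>. ennreal (exp (\<Sum>i\<in>I. \<theta> i * \<epsilon> i - (\<theta> i)\<^sup>2 / 2)))"
    (is "?S = ?D")
proof -
  define N where "N i = distr std_normal_distribution std_normal_distribution (\<lambda>x. x + \<theta> i)" for i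
  have N: "prob_space (N i)" for i
    unfolding N_def by (intro std_normal.prob_space_distr) simp
  interpret N: product_prob_space N UNIV
    by (intro product_prob_spaceI N)
  have sets_N: "sets (N i) = sets borel" for i
    by (simp add: N_def)
  have emN: "emeasure (N i) A = emeasure std_normal_distribution {x. x + \<theta> i \<in> A}"
    if "A \<in> sets borel" for A i
    unfolding N_def using that
    by (subst emeasure_distr) (auto intro!: arg_cong[where f="emeasure _"])
  have "?S = PiM I N"
  proof (rule N.PiM_eqI[OF assms])
    show "sets ?S = sets (PiM I N)"
      by (auto intro!: sets_PiM_cong simp: sets_N)
  next
    fix A assume A: "\<And>i. i \<in> I \<Longrightarrow> A i \<in> sets (N i)"
    have A': "A i \<in> sets borel" if "i \<in> I" for i using A[OF that] by (simp add: sets_N)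
    have "emeasure ?S (Pi\<^sub>E I A)
        = emeasure (\<Pi>\<^sub>M i\<in>I. std_normal_distribution) (\<Pi>\<^sub>E i\<in>I. {x. x + \<theta> i \<in> A i})"
      using A' assms
      by (subst emeasure_distr)
         (auto intro!: arg_cong[where f="emeasure _"] sets_PiM_I_finite simp: space_PiM PiE_iff)
    also have "\<dots> = (\<Prod>i\<in>I. emeasure std_normal_distribution {x. x + \<theta> i \<in> A i})"
    proof (intro std_normal_product.emeasure_PiM assms)
      fix i assume "i \<in> I"
      then have [measurable]: "A i \<in> sets borel" by (rule A')
      show "{x. x + \<theta> i \<in> A i} \<in> sets std_normal_distribution" by simp
    qed
    also have "\<dots> = (\<Prod>i\<in>I. emeasure (N i) (A i))"
      by (intro prod.cong refl) (simp add: emN A')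
    finally show "emeasure ?S (Pi\<^sub>E I A) = (\<Prod>i\<in>I. emeasure (N i) (A i))" .
  qed
  moreover have "?D = PiM I N"
  proof (rule N.PiM_eqI[OF assms])
    show "sets ?D = sets (PiM I N)"
      by (auto intro!: sets_PiM_cong simp: sets_N)
  next
    fix A assume A: "\<And>i. i \<in> I \<Longrightarrow> A i \<in> sets (N i)"
    have A': "A i \<in> sets borel" if "i \<in> I" for i using A[OF that] by (simp add: sets_N)
    have "emeasure ?D (Pi\<^sub>E I A) = (\<integral>\<^sup>+ \<epsilon>. ennreal (exp (\<Sum>i\<in>I. \<theta> i * \<epsilon> i - (\<theta> i)\<^sup>2 / 2)) *
        indicator (Pi\<^sub>E I A) \<epsilon> \<partial>(\<Pi>\<^sub>M i\<in>I. std_normal_distribution))"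
      using A' assms by (intro emeasure_density) (auto intro!: sets_PiM_I_finite)
    also have "\<dots> = (\<integral>\<^sup>+ \<epsilon>. (\<Prod>i\<in>I. ennreal (exp (\<theta> i * \<epsilon> i - (\<theta> i)\<^sup>2 / 2)) * indicator (A i) (\<epsilon> i))
        \<partial>(\<Pi>\<^sub>M i\<in>I. std_normal_distribution))"
    proof (intro nn_integral_cong)
      fix \<epsilon> assume "\<epsilon> \<in> space (\<Pi>\<^sub>M i\<in>I. std_normal_distribution)"
      then have "\<epsilon> \<in> extensional I" by (auto simp: space_PiM PiE_iff)
      then have "(indicator (Pi\<^sub>E I A) \<epsilon> :: ennreal) = (\<Prod>i\<in>I. indicator (A i) (\<epsilon> i))"
        using assms by (auto simp: indicator_def PiE_iff)
      then show "ennreal (exp (\<Sum>i\<in>I. \<theta> i * \<epsilon> i - (\<theta> i)\<^sup>2 / 2)) * indicator (Pi\<^sub>E I A) \<epsilon>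
          = (\<Prod>i\<in>I. ennreal (exp (\<theta> i * \<epsilon> i - (\<theta> i)\<^sup>2 / 2)) * indicator (A i) (\<epsilon> i))"
        by (simp add: exp_sum assms prod_ennreal prod.distrib)
    qed
    also have "\<dots> = (\<Prod>i\<in>I. \<integral>\<^sup>+ x. ennreal (exp (\<theta> i * x - (\<theta> i)\<^sup>2 / 2)) * indicator (A i) x
        \<partial>std_normal_distribution)"
      using A' by (intro std_normal_product.product_nn_integral_prod assms) auto
    also have "\<dots> = (\<Prod>i\<in>I. emeasure (N i) (A i))"
      by (intro prod.cong refl) (simp add: emN A' std_normal_shift)
    finally show "emeasure ?D (Pi\<^sub>E I A) = (\<Prod>i\<in>I. emeasure (N i) (A i))" .
  qed
  ultimately show ?thesis by simp
qed

section \<open>The law of the observations\<close>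

lemma sets_std_normal_PiM:
  "sets (\<Pi>\<^sub>M i\<in>I. std_normal_distribution) = sets (\<Pi>\<^sub>M i\<in>I. borel)"
  by (auto intro!: sets_PiM_cong)

lemma measurable_observation:
  "(\<lambda>\<epsilon>. \<lambda>i\<in>{1..n}. f (real i / real n) + \<sigma> * \<epsilon> i)
    \<in> (\<Pi>\<^sub>M i\<in>{1..n}. std_normal_distribution) \<rightarrow>\<^sub>M data_space n"
proof -
  have "(\<lambda>\<epsilon>. \<lambda>i\<in>{1..n}. f (real i / real n) + \<sigma> * \<epsilon> i) \<in> data_space n \<rightarrow>\<^sub>M data_space n"
    by measurable
  then show ?thesis
    by (simp add: measurable_cong_sets[OF sets_std_normal_PiM refl])
qed

lemma prob_space_data_law: "prob_space (data_law n \<sigma> f)"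
  unfolding data_law_def
  by (intro prob_space.prob_space_distr prob_space_std_normal_PiM measurable_observation)

lemma space_data_law: "space (data_law n \<sigma> f) = space (data_space n)"
  and sets_data_law: "sets (data_law n \<sigma> f) = sets (data_space n)"
  by (simp_all add: data_law_def)

text \<open>Since a likelihood ratio \<open>\<Lambda>\<close> satisfies \<open>\<Lambda> \<le> \<tau> + \<Lambda>\<^sup>2 / \<tau>\<close>, a bound on its second moment
  suffices to change the measure.\<close>

lemma emeasure_data_law_le:
  assumes A: "A \<in> sets (data_space n)" and "\<sigma> > 0" and "\<tau> > 0"
  shows "emeasure (data_law n \<sigma> g) A \<le> ennreal \<tau> * emeasure (data_law n \<sigma> f) A +
    ennreal (exp (\<Sum>i\<in>{1..n}. ((g (real i / real n) - f (real i / real n)) / \<sigma>)\<^sup>2) / \<tau>)"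
proof -
  define I where "I = {1..n}"
  define E where "E = (\<Pi>\<^sub>M i\<in>I. std_normal_distribution)"
  define \<theta> where "\<theta> i = (g (real i / real n) - f (real i / real n)) / \<sigma>" for i :: nat
  define T where "T \<epsilon> = (\<lambda>i\<in>I. f (real i / real n) + \<sigma> * \<epsilon> i)" for \<epsilon> :: "nat \<Rightarrow> real"
  define \<Lambda> where "\<Lambda> \<epsilon> = exp (\<Sum>i\<in>I. \<theta> i * \<epsilon> i - (\<theta> i)\<^sup>2 / 2)" for \<epsilon> :: "nat \<Rightarrow> real"
  have fin: "finite I" by (simp add: I_def)
  have T[measurable]: "T \<in> E \<rightarrow>\<^sub>M data_space n"
    using measurable_observation[where n=n and f=f and \<sigma>=\<sigma>] by (simp add: T_def[abs_def] E_def I_def)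
  have sE: "sets E = sets (data_space n)"
    unfolding E_def I_def by (rule sets_std_normal_PiM)
  have shift: "(\<lambda>\<epsilon>. \<lambda>i\<in>I. \<epsilon> i + \<theta> i) \<in> E \<rightarrow>\<^sub>M E"
    unfolding E_def by measurable
  have \<Lambda>[measurable]: "\<Lambda> \<in> borel_measurable E"
    unfolding \<Lambda>_def E_def by measurable
  have [measurable]: "A \<in> sets (data_space n)" by fact
  have lawf: "data_law n \<sigma> f = distr E (data_space n) T"
    by (simp add: data_law_def E_def T_def[abs_def] I_def)
  \<comment> \<open>The signal \<open>g\<close> produces the same data as \<open>f\<close> with the
    noise shifted by \<open>\<theta>\<close>, so the shift formula exhibits \<open>\<Lambda>\<close>
    as the likelihood ratio.\<close>
  have "data_law n \<sigma> g = distr E (data_space n) (\<lambda>\<epsilon>. T (\<lambda>i\<in>I. \<epsilon> i + \<theta> i))"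
    unfolding data_law_def E_def T_def I_def \<theta>_def
    using \<open>\<sigma> > 0\<close> by (intro distr_cong) (auto simp: field_simps restrict_def)
  also have "\<dots> = distr (distr E E (\<lambda>\<epsilon>. \<lambda>i\<in>I. \<epsilon> i + \<theta> i)) (data_space n) T"
    by (subst distr_distr[OF T shift]) (simp add: comp_def)
  also have "distr E E (\<lambda>\<epsilon>. \<lambda>i\<in>I. \<epsilon> i + \<theta> i) = density E (\<lambda>\<epsilon>. ennreal (\<Lambda> \<epsilon>))"
    unfolding E_def \<Lambda>_def by (rule std_normal_PiM_shift[OF fin])
  finally have lawg: "data_law n \<sigma> g = distr (density E (\<lambda>\<epsilon>. ennreal (\<Lambda> \<epsilon>))) (data_space n) T" .
  have TA: "T -` A \<inter> space E \<in> sets E"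
    using T A by (rule measurable_sets)
  have "emeasure (data_law n \<sigma> g) A = (\<integral>\<^sup>+ \<epsilon>. ennreal (\<Lambda> \<epsilon>) * indicator (T -` A \<inter> space E) \<epsilon> \<partial>E)"
    unfolding lawg using TA T A by (subst emeasure_distr) (auto simp: emeasure_density simp del: One_nat_def)
  also have "\<dots> \<le> (\<integral>\<^sup>+ \<epsilon>. ennreal \<tau> * indicator (T -` A \<inter> space E) \<epsilon> + ennreal ((\<Lambda> \<epsilon>)\<^sup>2 / \<tau>) \<partial>E)"
  proof (intro nn_integral_mono)
    fix \<epsilon>
    have pos: "\<Lambda> \<epsilon> > 0" by (simp add: \<Lambda>_def)
    have "\<Lambda> \<epsilon> \<le> \<tau> + (\<Lambda> \<epsilon>)\<^sup>2 / \<tau>"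
    proof (cases "\<Lambda> \<epsilon> \<le> \<tau>")
      case False
      then have "\<Lambda> \<epsilon> * \<tau> \<le> (\<Lambda> \<epsilon>)\<^sup>2" using pos by (simp add: power2_eq_square)
      then have "\<Lambda> \<epsilon> \<le> (\<Lambda> \<epsilon>)\<^sup>2 / \<tau>" using \<open>\<tau> > 0\<close> by (simp add: field_simps)
      then show ?thesis using \<open>\<tau> > 0\<close> by linarith
    qed (use \<open>\<tau> > 0\<close> in \<open>simp add: add_increasing2\<close>)
    then show "ennreal (\<Lambda> \<epsilon>) * indicator (T -` A \<inter> space E) \<epsilon>
        \<le> ennreal \<tau> * indicator (T -` A \<inter> space E) \<epsilon> + ennreal ((\<Lambda> \<epsilon>)\<^sup>2 / \<tau>)"
      using \<open>\<tau> > 0\<close>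
      by (auto simp: indicator_def ennreal_plus[symmetric] simp del: ennreal_plus intro!: ennreal_leI)
  qed
  also have "\<dots> = ennreal \<tau> * emeasure E (T -` A \<inter> space E) + (\<integral>\<^sup>+ \<epsilon>. ennreal ((\<Lambda> \<epsilon>)\<^sup>2 / \<tau>) \<partial>E)"
    using TA by (subst nn_integral_add) (auto simp: nn_integral_cmult_indicator)
  also have "emeasure E (T -` A \<inter> space E) = emeasure (data_law n \<sigma> f) A"
    unfolding lawf by (rule emeasure_distr[OF T A, symmetric])
  also have "(\<integral>\<^sup>+ \<epsilon>. ennreal ((\<Lambda> \<epsilon>)\<^sup>2 / \<tau>) \<partial>E)
      = (\<integral>\<^sup>+ \<epsilon>. ennreal (exp (- (\<Sum>i\<in>I. (\<theta> i)\<^sup>2)) / \<tau>) * ennreal (exp (\<Sum>i\<in>I. (2 * \<theta> i) * \<epsilon> i)) \<partial>E)"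
  proof (intro nn_integral_cong)
    fix \<epsilon>
    have "(\<Lambda> \<epsilon>)\<^sup>2 = exp (2 * (\<Sum>i\<in>I. \<theta> i * \<epsilon> i - (\<theta> i)\<^sup>2 / 2))"
      by (simp add: \<Lambda>_def exp_double)
    also have "2 * (\<Sum>i\<in>I. \<theta> i * \<epsilon> i - (\<theta> i)\<^sup>2 / 2) = - (\<Sum>i\<in>I. (\<theta> i)\<^sup>2) + (\<Sum>i\<in>I. (2 * \<theta> i) * \<epsilon> i)"
      by (simp add: sum_subtractf sum_distrib_left sum_divide_distrib[symmetric] algebra_simps)
    finally show "ennreal ((\<Lambda> \<epsilon>)\<^sup>2 / \<tau>)
        = ennreal (exp (- (\<Sum>i\<in>I. (\<theta> i)\<^sup>2)) / \<tau>) * ennreal (exp (\<Sum>i\<in>I. (2 * \<theta> i) * \<epsilon> i))"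
      using \<open>\<tau> > 0\<close> by (subst ennreal_mult[symmetric]) (auto simp: exp_diff exp_minus divide_inverse mult_ac)
  qed
  \<comment> \<open>The linear form with coefficients \<open>2 * \<theta> i\<close> has exponential
    moment \<open>exp (2 * s)\<close>, where \<open>s\<close> is the sum of the
    \<open>(\<theta> i)\<^sup>2\<close>; the factor \<open>exp (- s)\<close> leaves
    \<open>exp s\<close>.\<close>
  also have "\<dots> = ennreal (exp (- (\<Sum>i\<in>I. (\<theta> i)\<^sup>2)) / \<tau>) * ennreal (exp ((\<Sum>i\<in>I. (2 * \<theta> i)\<^sup>2) / 2))"
    unfolding E_def
    by (subst nn_integral_cmult)
       (auto simp: nn_integral_exp_linear_std_normal[OF fin] simp del: power_mult_distrib)
  also have "\<dots> = ennreal (exp (\<Sum>i\<in>I. (\<theta> i)\<^sup>2) / \<tau>)"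
    using \<open>\<tau> > 0\<close>
    by (subst ennreal_mult[symmetric])
       (auto simp: exp_add[symmetric] power_mult_distrib sum_distrib_left[symmetric])
  finally show ?thesis by (simp add: \<theta>_def I_def)
qed

text \<open>Separation makes the events \<open>A j\<close> of estimating \<open>g j\<close> to
  within \<open>\<psi> / 2\<close> disjoint, so under the reference signal \<open>f\<close> their
  probabilities sum to at most 1. After the change of measure they average at most 1/2 under their
  own signals; hence some \<open>g j\<close> is missed with probability at least 1/2, at a cost of
  \<open>\<psi> / 2\<close>.\<close>

lemma sup_risk_lower_bound:
  fixes g :: "nat \<Rightarrow> real \<Rightarrow> real"
  assumes fhat: "fhat \<in> estimators n F" and "\<sigma> > 0" and "\<psi> > 0"
    and g: "\<And>j. j < M \<Longrightarrow> g j \<in> F"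
    and sep: "\<And>j k. j < M \<Longrightarrow> k < M \<Longrightarrow> j \<noteq> k \<Longrightarrow> \<exists>x\<in>{0..1}. \<psi> \<le> \<bar>g j x - g k x\<bar>"
    and v: "\<And>j. j < M \<Longrightarrow> (\<Sum>i\<in>{1..n}. ((g j (real i / real n) - f (real i / real n)) / \<sigma>)\<^sup>2) \<le> v"
    and M: "16 * exp v \<le> real M"
  shows "ennreal (\<psi> / 4) \<le> (SUP f\<in>F. sup_risk n \<sigma> fhat f)"
proof -
  define loss where "loss j y = sup_norm01 (\<lambda>x. fhat y x - g j x)" for j y
  define A where "A j = {y \<in> space (data_space n). loss j y < ennreal (\<psi> / 2)}" for j
  have M0: "M > 0" using M by (cases M) (auto simp: mult_le_0_iff not_le[symmetric])
  have loss[measurable]: "loss j \<in> borel_measurable (data_space n)" if "j < M" for j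
    using fhat g[OF that] unfolding estimators_def loss_def by auto
  have A: "A j \<in> sets (data_space n)" if "j < M" for j
    unfolding A_def using loss[OF that] by measurable
  have disj: "disjoint_family_on A {..<M}"
    unfolding disjoint_family_on_def
  proof (intro ballI impI)
    fix j k assume jk: "j \<in> {..<M}" "k \<in> {..<M}" "j \<noteq> k"
    then obtain x where x: "x \<in> {0..1}" "\<psi> \<le> \<bar>g j x - g k x\<bar>" using sep[of j k] by auto
    have False if "y \<in> A j" "y \<in> A k" for y
    proof -
      have le: "ennreal \<bar>fhat y x - g l x\<bar> \<le> loss l y" for l
        unfolding loss_def sup_norm01_def using x(1) by (rule SUP_upper)
      have "ennreal \<bar>fhat y x - g j x\<bar> < ennreal (\<psi> / 2)" "ennreal \<bar>fhat y x - g k x\<bar> < ennreal (\<psi> / 2)"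
        using that le[of j] le[of k] by (auto simp: A_def intro: le_less_trans)
      then have "\<bar>fhat y x - g j x\<bar> < \<psi> / 2" "\<bar>fhat y x - g k x\<bar> < \<psi> / 2"
        by (auto simp: ennreal_less_iff)
      with x(2) show False by linarith
    qed
    then show "A j \<inter> A k = {}" by auto
  qed
  interpret P0: prob_space "data_law n \<sigma> f" by (rule prob_space_data_law)
  \<comment> \<open>This threshold splits the target 1/2 evenly: the reference probabilities
    contribute at most \<open>M / 4\<close> to the sum over \<open>j\<close>, and each second moment
    term is at most 1/4 because \<open>16 * exp v \<le> real M\<close>.\<close>
  let ?\<tau> = "real M / 4"
  have bnd: "measure (data_law n \<sigma> (g j)) (A j) \<le> ?\<tau> * measure (data_law n \<sigma> f) (A j) + 1 / 4"
    if j: "j < M" for j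
  proof -
    interpret Pj: prob_space "data_law n \<sigma> (g j)" by (rule prob_space_data_law)
    have "ennreal (measure (data_law n \<sigma> (g j)) (A j))
        \<le> ennreal ?\<tau> * ennreal (measure (data_law n \<sigma> f) (A j)) +
          ennreal (exp (\<Sum>i\<in>{1..n}. ((g j (real i / real n) - f (real i / real n)) / \<sigma>)\<^sup>2) / ?\<tau>)"
      using emeasure_data_law_le[OF A[OF j] \<open>\<sigma> > 0\<close>, of ?\<tau> "g j" f] M0
      by (simp add: Pj.emeasure_eq_measure P0.emeasure_eq_measure)
    also have "\<dots> = ennreal (?\<tau> * measure (data_law n \<sigma> f) (A j) +
        exp (\<Sum>i\<in>{1..n}. ((g j (real i / real n) - f (real i / real n)) / \<sigma>)\<^sup>2) / ?\<tau>)"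
      using M0 by (simp add: ennreal_mult'[symmetric] ennreal_plus[symmetric] del: ennreal_plus)
    finally have "measure (data_law n \<sigma> (g j)) (A j) \<le> ?\<tau> * measure (data_law n \<sigma> f) (A j) +
        exp (\<Sum>i\<in>{1..n}. ((g j (real i / real n) - f (real i / real n)) / \<sigma>)\<^sup>2) / ?\<tau>"
      using M0 by (subst (asm) ennreal_le_iff) (auto intro!: add_nonneg_nonneg)
    also have "exp (\<Sum>i\<in>{1..n}. ((g j (real i / real n) - f (real i / real n)) / \<sigma>)\<^sup>2) / ?\<tau> \<le> exp v / ?\<tau>"
      using v[OF j] by (intro divide_right_mono) auto
    also have "exp v / ?\<tau> \<le> 1 / 4" using M M0 by (simp add: field_simps)
    finally show ?thesis by simp
  qed
  have "(\<Sum>j<M. measure (data_law n \<sigma> f) (A j)) = measure (data_law n \<sigma> f) (\<Union>j<M. A j)"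
    using A disj by (intro P0.finite_measure_finite_Union[symmetric]) (auto simp: sets_data_law)
  also have "\<dots> \<le> 1" by simp
  finally have tot: "(\<Sum>j<M. measure (data_law n \<sigma> f) (A j)) \<le> 1" .
  have "(\<Sum>j<M. measure (data_law n \<sigma> (g j)) (A j))
      \<le> (\<Sum>j<M. ?\<tau> * measure (data_law n \<sigma> f) (A j) + 1 / 4)"
    by (intro sum_mono bnd) auto
  also have "\<dots> = ?\<tau> * (\<Sum>j<M. measure (data_law n \<sigma> f) (A j)) + M / 4"
    by (simp add: sum.distrib sum_distrib_left)
  also have "\<dots> \<le> ?\<tau> * 1 + M / 4"
    using tot by (intro add_right_mono mult_left_mono) auto
  also have "\<dots> = (\<Sum>j<M. 1 / 2)" by simp
  finally have "\<not> (\<forall>j\<in>{..<M}. 1 / 2 < measure (data_law n \<sigma> (g j)) (A j))"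
    using sum_strict_mono[of "{..<M}" "\<lambda>_. 1 / 2" "\<lambda>j. measure (data_law n \<sigma> (g j)) (A j)"] M0 by auto
  then obtain j where j: "j < M" and pj: "measure (data_law n \<sigma> (g j)) (A j) \<le> 1 / 2"
    by (auto simp: not_less)
  interpret Pj: prob_space "data_law n \<sigma> (g j)" by (rule prob_space_data_law)
  let ?B = "space (data_law n \<sigma> (g j)) - A j"
  have Aj: "A j \<in> Pj.events" using A[OF j] by (simp add: sets_data_law)
  have "ennreal (\<psi> / 4) \<le> ennreal (\<psi> / 2) * ennreal (measure (data_law n \<sigma> (g j)) ?B)"
    using pj \<open>\<psi> > 0\<close> Aj by (subst ennreal_mult[symmetric]) (auto intro!: ennreal_leI simp: Pj.prob_compl)
  also have "\<dots> = (\<integral>\<^sup>+ y. ennreal (\<psi> / 2) * indicator ?B y \<partial>data_law n \<sigma> (g j))"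
    using Aj by (subst nn_integral_cmult_indicator) (auto simp: Pj.emeasure_eq_measure)
  also have "\<dots> \<le> (\<integral>\<^sup>+ y. loss j y \<partial>data_law n \<sigma> (g j))"
    by (intro nn_integral_mono) (auto simp: A_def space_data_law indicator_def not_less)
  also have "\<dots> = sup_risk n \<sigma> fhat (g j)" by (simp add: sup_risk_def loss_def)
  also have "\<dots> \<le> (SUP f\<in>F. sup_risk n \<sigma> fhat f)" using g[OF j] by (rule SUP_upper)
  finally show ?thesis .
qed

subsection \<open>Local linear interpolation of block means\<close>

text \<open>The mean value theorem turns the remainder into a difference of slopes times
  \<open>y - x\<close>, which the Hoelder condition bounds. The factor \<open>1 / r\<close> that
  integration would gain is immaterial for the rate.\<close>

lemma holder_class_taylor:
  assumes f: "f \<in> holder_class r L" and "1 \<le> r" "0 \<le> L" and x: "x \<in> {0..1}" and y: "y \<in> {0..1}"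
  shows "\<bar>f y - f x - deriv01 f x * (y - x)\<bar> \<le> L * \<bar>y - x\<bar> powr r"
proof -
  have der: "(f has_vector_derivative deriv01 f t) (at t within {0..1})" if "t \<in> {0..1}" for t
    using f that unfolding holder_class_def differentiable_on_def deriv01_def
    by (simp add: vector_derivative_works)
  have mvt: "\<exists>t\<in>{a..b}. f b - f a = deriv01 f t * (b - a)" if "0 \<le> a" "a \<le> b" "b \<le> 1" for a b
  proof -
    have "\<exists>t\<in>{a..b}. f b - f a = (\<lambda>h. h *\<^sub>R deriv01 f t) (b - a)"
    proof (rule mvt_very_simple[OF \<open>a \<le> b\<close>])
      fix t assume "a \<le> t" "t \<le> b"
      with that have "(f has_vector_derivative deriv01 f t) (at t within {0..1})" by (intro der) auto
      then show "(f has_derivative (\<lambda>h. h *\<^sub>R deriv01 f t)) (at t within {a..b})"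
        unfolding has_vector_derivative_def using that by (auto intro: has_derivative_subset)
    qed
    then show ?thesis by (simp add: mult.commute)
  qed
  obtain t where t: "t \<in> {min x y..max x y}" "f y - f x = deriv01 f t * (y - x)"
  proof (cases "x \<le> y")
    case True
    then show ?thesis using mvt[of x y] x y that by auto
  next
    case False
    then obtain t where "t \<in> {y..x}" "f x - f y = deriv01 f t * (x - y)"
      using mvt[of y x] x y by auto
    with False show ?thesis by (intro that[of t]) (auto simp: algebra_simps)
  qed
  have t01: "t \<in> {0..1}" using t(1) x y by auto
  have "f y - f x - deriv01 f x * (y - x) = (deriv01 f t - deriv01 f x) * (y - x)"
    by (simp add: t(2) algebra_simps)
  then have "\<bar>f y - f x - deriv01 f x * (y - x)\<bar> = \<bar>deriv01 f t - deriv01 f x\<bar> * \<bar>y - x\<bar>"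
    by (simp add: abs_mult)
  also have "\<bar>deriv01 f t - deriv01 f x\<bar> \<le> L * \<bar>t - x\<bar> powr (r - 1)"
    using f t01 x by (auto simp: holder_class_def)
  also have "\<bar>t - x\<bar> powr (r - 1) \<le> \<bar>y - x\<bar> powr (r - 1)"
    using t(1) \<open>1 \<le> r\<close> by (intro powr_mono2) (auto simp: min_def max_def split: if_splits)
  also have "L * \<bar>y - x\<bar> powr (r - 1) * \<bar>y - x\<bar> = L * \<bar>y - x\<bar> powr r"
    by (cases "y = x") (auto simp: powr_diff)
  finally show ?thesis using \<open>0 \<le> L\<close> by (simp add: mult_left_mono mult_right_mono)
qed

text \<open>Blocks are numbered from 0 but design points from 1, whence the \<open>+ 1\<close>. The
  last \<open>n mod K\<close> observations lie in no block with index below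
  \<open>n div K\<close>.\<close>

definition block :: "nat \<Rightarrow> nat \<Rightarrow> nat set" where
  "block K j = {j * K + 1..j * K + K}"

definition block_mean :: "nat \<Rightarrow> nat \<Rightarrow> (nat \<Rightarrow> real) \<Rightarrow> real" where
  "block_mean K j y = (\<Sum>i\<in>block K j. y i) / real K"

text \<open>The cap leaves room for a complete block to the right of the chosen one; near the right
  endpoint the estimator extrapolates from the last two complete blocks.\<close>

definition block_index :: "nat \<Rightarrow> nat \<Rightarrow> real \<Rightarrow> nat" where
  "block_index n K x = min (nat \<lfloor>x * n / K\<rfloor>) (n div K - 2)"

text \<open>The position of \<open>x\<close> relative to the centres of mass of the design points
  \<open>i / n\<close> in the blocks \<open>j\<close> (position \<open>0\<close>) and \<open>j + 1\<close> (position \<open>1\<close>).\<close>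

definition block_position :: "nat \<Rightarrow> nat \<Rightarrow> nat \<Rightarrow> real \<Rightarrow> real" where
  "block_position n K j x = x * n / K - j - (real K + 1) / (2 * K)"

definition block_estimator :: "nat \<Rightarrow> nat \<Rightarrow> (nat \<Rightarrow> real) \<Rightarrow> real \<Rightarrow> real" where
  "block_estimator n K y x =
    (let j = block_index n K x; s = block_position n K j x
     in (1 - s) * block_mean K j y + s * block_mean K (j + 1) y)"

lemma card_block: "card (block K j) = K"
  by (simp add: block_def)

lemma block_subset:
  assumes "j < n div K"
  shows "block K j \<subseteq> {1..n}"
proof -
  have "j * K + K \<le> (n div K) * K"
    using mult_le_mono1[of "Suc j" "n div K" K] assms by simp
  also have "\<dots> \<le> n" by simp
  finally show ?thesis by (auto simp: block_def)
qed

lemma block_mean_affine: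
  assumes "K > 0"
  shows "block_mean K j (\<lambda>i. a + b * (real i / n)) = a + b * ((j + (real K + 1) / (2 * K)) * K / n)"
proof -
  have "(\<Sum>i\<in>{m + 1..m + k}. real i) = k * m + k * (real k + 1) / 2" for m k :: nat
    by (induction k) (auto simp: field_simps)
  from this[of "j * K" K]
  have eq: "(\<Sum>i\<in>block K j. real i) = K * (j * K) + K * (real K + 1) / 2"
    by (simp add: block_def)
  have "(\<Sum>i\<in>block K j. a + b * (real i / n)) = K * a + b / n * (\<Sum>i\<in>block K j. real i)"
    by (simp add: sum.distrib card_block sum_distrib_left)
  also have "\<dots> = K * a + b / n * (K * (j * K) + K * (real K + 1) / 2)"
    by (simp only: eq)
  finally show ?thesis using assms
    by (cases "n = 0") (simp_all add: block_mean_def field_simps)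
qed

text \<open>The 3 in the last bound is the effect of the cap: \<open>x * n / K\<close> stays below
  \<open>n div K + 1\<close>, which exceeds the largest index \<open>n div K - 2\<close> by
  3.\<close>

lemma block_index_bounds:
  assumes "K > 0" "2 * K \<le> n" "x \<in> {0..1}"
  shows "block_index n K x + 1 < n div K"
    and "block_index n K x \<le> x * n / K" "x * n / K \<le> block_index n K x + 3"
proof -
  define X where "X = x * n / K"
  have X0: "0 \<le> X" using assms by (simp add: X_def)
  have "2 \<le> n div K" using assms by (simp add: less_eq_div_iff_mult_less_eq)
  then show "block_index n K x + 1 < n div K" by (auto simp: block_index_def min_def)
  have "n < (n div K + 1) * K" using assms(1) dividend_less_div_times[of K n] by simp
  then have "real n < (real (n div K) + 1) * K"
    by (metis of_nat_1 of_nat_add of_nat_less_iff of_nat_mult)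
  moreover have "x * n \<le> n" using assms by (simp add: mult_left_le_one_le)
  ultimately have up: "X < real (n div K) + 1"
    using assms(1) by (simp add: X_def pos_divide_less_eq)
  define m where "m = nat \<lfloor>X\<rfloor>"
  have fl: "real m \<le> X" "X < real m + 1" using X0 unfolding m_def by linarith+
  have idx: "block_index n K x = min m (n div K - 2)"
    by (simp add: block_index_def X_def m_def)
  show "block_index n K x \<le> x * n / K" "x * n / K \<le> block_index n K x + 3"
    unfolding X_def[symmetric] idx using fl up \<open>2 \<le> n div K\<close> by (auto simp: min_def)
qed

text \<open>The estimator reproduces affine functions exactly, so only the Taylor remainder of \<open>f\<close>
  contributes to the bias.\<close>

lemma block_estimator_error:
  assumes f: "f \<in> holder_class r L" and r: "1 \<le> r" "r \<le> 2" and "0 \<le> L"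
    and K: "K > 0" "2 * K \<le> n" and x: "x \<in> {0..1}"
    and y: "\<And>i. i \<in> {1..n} \<Longrightarrow> y i = f (real i / real n) + \<sigma> * \<epsilon> i"
    and Z: "\<And>j. j < n div K \<Longrightarrow> \<bar>block_mean K j (\<lambda>i. \<sigma> * \<epsilon> i)\<bar> \<le> Z"
  shows "\<bar>block_estimator n K y x - f x\<bar> \<le> 54 * L * (real K / real n) powr r + 5 * Z"
proof -
  define h where "h = real K / real n"
  define j where "j = block_index n K x"
  define s where "s = block_position n K j x"
  \<comment> \<open>The centre of mass of block \<open>j\<close>, about which \<open>f\<close> is
    expanded; \<open>x\<close> will be \<open>c + s * h\<close>.\<close>
  define c where "c = (j + (real K + 1) / (2 * K)) * h"
  define \<rho> where "\<rho> t = f t - f c - deriv01 f c * (t - c)" for t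
  have n: "n > 0" using K by auto
  have h: "h > 0" using K n by (simp add: h_def)
  note idx = block_index_bounds[OF K x, folded j_def]
  have half: "1 / 2 \<le> (real K + 1) / (2 * K)" "(real K + 1) / (2 * K) \<le> 1"
    using K by (auto simp: field_simps)
  have s: "-1 \<le> s" "s \<le> 3" unfolding s_def block_position_def using idx(2,3) half by linarith+
  have xs: "x = c + s * h"
    using K n by (simp add: c_def s_def h_def block_position_def field_simps)
  have "real j + 2 \<le> n div K" using idx(1) by simp
  also have "real (n div K) \<le> n / K" by (rule of_nat_div_le_of_nat)
  finally have jn: "(real j + 2) * h \<le> 1" using K n by (simp add: h_def field_simps)
  have c01: "c \<in> {0..1}"
  proof -
    have "c \<le> (real j + 2) * h" unfolding c_def using h half by (intro mult_right_mono) auto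
    then have "c \<le> 1" using jn by linarith
    then show ?thesis using h by (simp add: c_def)
  qed
  \<comment> \<open>The point \<open>x\<close> and the design points of both blocks lie within
    \<open>3 * h\<close> of \<open>c\<close>; the factor 9 is \<open>3 powr 2\<close>, which
    dominates \<open>3 powr r\<close>.\<close>
  have rem: "\<bar>\<rho> t\<bar> \<le> 9 * L * h powr r" if "t \<in> {0..1}" "\<bar>t - c\<bar> \<le> 3 * h" for t
  proof -
    have "\<bar>\<rho> t\<bar> \<le> L * \<bar>t - c\<bar> powr r"
      unfolding \<rho>_def by (rule holder_class_taylor[OF f r(1) \<open>0 \<le> L\<close> c01 that(1)])
    also have "\<dots> \<le> L * (3 * h) powr r"
      using that r \<open>0 \<le> L\<close> by (intro mult_left_mono powr_mono2) auto
    also have "(3 * h) powr r = 3 powr r * h powr r" using h by (simp add: powr_mult)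
    also have "(3::real) powr r \<le> 3 powr 2" using r by (intro powr_mono) auto
    finally show ?thesis using \<open>0 \<le> L\<close> by (simp add: mult_left_mono mult_right_mono mult_ac)
  qed
  have mean: "\<exists>e. \<bar>e\<bar> \<le> 9 * L * h powr r + Z \<and>
      block_mean K k y = f c + deriv01 f c * ((k + (real K + 1) / (2 * K)) * h - c) + e"
    if k: "k = j \<or> k = j + 1" for k
  proof -
    have kM: "k < n div K" using idx(1) k by auto
    have sub: "block K k \<subseteq> {1..n}" by (rule block_subset[OF kM])
    define e1 where "e1 = block_mean K k (\<lambda>i. \<rho> (real i / n))"
    define e2 where "e2 = block_mean K k (\<lambda>i. \<sigma> * \<epsilon> i)"
    have "block_mean K k y = block_mean K k (\<lambda>i. (f c - deriv01 f c * c) + deriv01 f c * (real i / n)) + e1 + e2"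
      unfolding e1_def e2_def block_mean_def add_divide_distrib[symmetric] sum.distrib[symmetric]
      using sub y by (intro arg_cong2[where f="(/)"] refl sum.cong) (auto simp: \<rho>_def algebra_simps)
    also have "block_mean K k (\<lambda>i. (f c - deriv01 f c * c) + deriv01 f c * (real i / n))
        = f c + deriv01 f c * ((k + (real K + 1) / (2 * K)) * h - c)"
      by (subst block_mean_affine[OF K(1)]) (simp add: h_def right_diff_distrib)
    finally have eq: "block_mean K k y =
        f c + deriv01 f c * ((k + (real K + 1) / (2 * K)) * h - c) + (e1 + e2)" by simp
    have "\<bar>\<Sum>i\<in>block K k. \<rho> (real i / n)\<bar> \<le> (\<Sum>i\<in>block K k. 9 * L * h powr r)"
    proof (rule order_trans[OF sum_abs sum_mono])
      fix i assume i: "i \<in> block K k"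
      have "real i / n \<in> {0..1}" using sub i by auto
      moreover have "\<bar>real i / n - c\<bar> \<le> 3 * h"
      proof -
        have "j * K \<le> i" "i \<le> (j + 2) * K" using i k by (auto simp: block_def)
        then have "real j * K \<le> i" "i \<le> (real j + 2) * K"
          by (metis of_nat_le_iff of_nat_mult, metis of_nat_le_iff of_nat_mult of_nat_add of_nat_numeral)
        then have "real j * h \<le> i / n" "i / n \<le> (real j + 2) * h"
          by (simp_all add: h_def divide_right_mono)
        moreover have "real j * h \<le> c" "c \<le> (real j + 2) * h"
          unfolding c_def using h half by (auto intro!: mult_right_mono)
        ultimately show ?thesis using h by (simp add: algebra_simps abs_le_iff)
      qed
      ultimately show "\<bar>\<rho> (real i / n)\<bar> \<le> 9 * L * h powr r" by (rule rem)
    qed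
    then have "\<bar>e1\<bar> \<le> 9 * L * h powr r"
      using K by (simp add: e1_def block_mean_def card_block abs_divide pos_divide_le_eq mult_ac)
    moreover have "\<bar>e2\<bar> \<le> Z" unfolding e2_def by (rule Z[OF kM])
    ultimately show ?thesis using eq by (intro exI[of _ "e1 + e2"]) auto
  qed
  from mean[of j] obtain e where e: "\<bar>e\<bar> \<le> 9 * L * h powr r + Z" "block_mean K j y = f c + e"
    by (auto simp: c_def)
  from mean[of "j + 1"] obtain e' where e': "\<bar>e'\<bar> \<le> 9 * L * h powr r + Z"
      "block_mean K (j + 1) y = f c + deriv01 f c * h + e'"
    by (auto simp: c_def algebra_simps)
  have \<rho>x: "\<bar>\<rho> x\<bar> \<le> 9 * L * h powr r"
  proof (rule rem[OF x])
    show "\<bar>x - c\<bar> \<le> 3 * h" using s h by (simp add: xs abs_mult)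
  qed
  \<comment> \<open>The weights sum to 1 and the two centres are \<open>h\<close> apart, so the
    affine part of the expansion cancels.\<close>
  have "block_estimator n K y x - f x = (1 - s) * e + s * e' - \<rho> x"
    unfolding block_estimator_def Let_def j_def[symmetric] s_def[symmetric] e(2) e'(2)
    by (simp add: \<rho>_def) (simp add: xs algebra_simps)
  then have "\<bar>block_estimator n K y x - f x\<bar> \<le> \<bar>1 - s\<bar> * \<bar>e\<bar> + \<bar>s\<bar> * \<bar>e'\<bar> + \<bar>\<rho> x\<bar>"
    by (simp add: abs_mult[symmetric])
  \<comment> \<open>Since \<open>s\<close> lies in [-1, 3], the weights are at most 2 and 3, which
    gives the 5 and 2 * 9 + 3 * 9 + 9 = 54.\<close>
  also have "\<dots> \<le> 2 * (9 * L * h powr r + Z) + 3 * (9 * L * h powr r + Z) + 9 * L * h powr r"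
    using s e(1) e'(1) \<rho>x by (intro add_mono mult_mono) auto
  finally show ?thesis by (simp add: h_def)
qed

text \<open>Even over an uncountable index set, a supremum of continuous functions is lower
  semicontinuous: its strict superlevel sets are unions of open sets.\<close>

lemma borel_measurable_SUP_continuous:
  fixes H :: "'b \<Rightarrow> 'a::topological_space \<Rightarrow> ennreal"
  assumes "\<And>x. x \<in> S \<Longrightarrow> continuous_on UNIV (H x)"
  shows "(\<lambda>a. SUP x\<in>S. H x a) \<in> borel_measurable borel"
proof (rule borel_measurableI_greater)
  fix t
  have "{a. t < (SUP x\<in>S. H x a)} = (\<Union>x\<in>S. {a. t < H x a})" by (auto simp: less_SUP_iff)
  also have "open \<dots>" using assms by (intro open_UN ballI open_Collect_less) auto
  finally show "{a \<in> space borel. t < (SUP x\<in>S. H x a)} \<in> sets borel" by simp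
qed

text \<open>Padding the data with zeros moves the question to \<open>nat \<Rightarrow> real\<close>
  with its product topology, where the estimate at each point is continuous and the loss is a
  supremum of continuous functions. For \<open>x\<close> in the unit interval only coordinates in
  \<open>{1..n}\<close> enter, so padding changes nothing.\<close>

lemma block_estimator_estimators:
  assumes K: "K > 0" "2 * K \<le> n"
  shows "block_estimator n K \<in> estimators n F"
proof -
  define ext where "ext y = (\<lambda>i. if i \<in> {1..n} then y i else 0)" for y :: "nat \<Rightarrow> real"
  have ext: "ext \<in> data_space n \<rightarrow>\<^sub>M borel"
  proof (rule measurable_coordinatewise_then_product)
    fix i show "(\<lambda>y. ext y i) \<in> borel_measurable (data_space n)"
      by (cases "i \<in> {1..n}") (auto simp: ext_def simp del: atLeastAtMost_iff)
  qed
  have eq: "block_estimator n K y x = block_estimator n K (ext y) x" if "x \<in> {0..1}" for x y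
  proof -
    have "block_mean K j y = block_mean K j (ext y)" if "j < n div K" for j
      unfolding block_mean_def ext_def using block_subset[OF that]
      by (intro arg_cong2[where f="(/)"] refl sum.cong) auto
    with block_index_bounds(1)[OF K that] show ?thesis
      by (simp add: block_estimator_def Let_def)
  qed
  have cont: "continuous_on UNIV (\<lambda>a. block_estimator n K a x)" for x
    unfolding block_estimator_def Let_def block_mean_def
    by (intro continuous_intros continuous_on_product_coordinates) (use K in auto)
  have "(\<lambda>y. block_estimator n K (ext y) x) \<in> borel_measurable (data_space n)" for x
    using measurable_compose[OF ext borel_measurable_continuous_onI[OF cont]] .
  moreover have "(\<lambda>y. sup_norm01 (\<lambda>x. block_estimator n K (ext y) x - f x))
      \<in> borel_measurable (data_space n)" for f
    unfolding sup_norm01_def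
    by (rule measurable_compose[OF ext borel_measurable_SUP_continuous])
       (intro continuous_on_ennreal continuous_intros cont)
  moreover have "(\<lambda>y. block_estimator n K y x) = (\<lambda>y. block_estimator n K (ext y) x)" if "x \<in> {0..1}" for x
    using eq[OF that] by (rule HOL.ext)
  moreover have "(\<lambda>y. sup_norm01 (\<lambda>x. block_estimator n K y x - f x))
      = (\<lambda>y. sup_norm01 (\<lambda>x. block_estimator n K (ext y) x - f x))" for f
    unfolding sup_norm01_def by (intro HOL.ext SUP_cong refl) (simp only: eq[symmetric])
  ultimately show ?thesis
    by (simp add: estimators_def)
qed

lemma nn_integral_exp_block_mean:
  assumes "K > 0" "j < n div K"
  shows "(\<integral>\<^sup>+ \<epsilon>. ennreal (exp (c * block_mean K j (\<lambda>i. \<sigma> * \<epsilon> i))) \<partial>(\<Pi>\<^sub>M i\<in>{1..n}. std_normal_distribution))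
    = ennreal (exp (c\<^sup>2 * \<sigma>\<^sup>2 / (2 * K)))"
proof -
  define a where "a i = (if i \<in> block K j then c * \<sigma> / K else 0)" for i
  have sub: "block K j \<subseteq> {1..n}" by (rule block_subset[OF assms(2)])
  have int: "{1..n} \<inter> block K j = block K j" using sub by auto
  have lin: "(\<Sum>i\<in>{1..n}. a i * \<epsilon> i) = c * block_mean K j (\<lambda>i. \<sigma> * \<epsilon> i)" for \<epsilon>
  proof -
    have "(\<Sum>i\<in>{1..n}. a i * \<epsilon> i) = (\<Sum>i\<in>{1..n}. if i \<in> block K j then c * \<sigma> / K * \<epsilon> i else 0)"
      by (intro sum.cong) (auto simp: a_def)
    also have "\<dots> = (\<Sum>i\<in>block K j. c * \<sigma> / K * \<epsilon> i)"
      by (simp only: sum.inter_restrict[OF finite_atLeastAtMost, symmetric] int)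
    also have "\<dots> = c * block_mean K j (\<lambda>i. \<sigma> * \<epsilon> i)"
      by (simp add: block_mean_def sum_distrib_left sum_divide_distrib mult_ac)
    finally show ?thesis .
  qed
  have "(\<Sum>i\<in>{1..n}. (a i)\<^sup>2) = (\<Sum>i\<in>{1..n}. if i \<in> block K j then (c * \<sigma> / K)\<^sup>2 else 0)"
    by (intro sum.cong) (auto simp: a_def)
  also have "\<dots> = (\<Sum>i\<in>block K j. (c * \<sigma> / K)\<^sup>2)"
    by (simp only: sum.inter_restrict[OF finite_atLeastAtMost, symmetric] int)
  also have "\<dots> = c\<^sup>2 * \<sigma>\<^sup>2 / K"
    using assms(1) by (simp add: card_block power2_eq_square)
  finally have "(\<Sum>i\<in>{1..n}. (a i)\<^sup>2) / 2 = c\<^sup>2 * \<sigma>\<^sup>2 / (2 * K)" by simp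
  then show ?thesis
    using nn_integral_exp_linear_std_normal[of "{1..n}" a] by (simp only: lin finite_atLeastAtMost)
qed

text \<open>The bound \<open>exp u \<ge> u\<close> at \<open>u = c * (w - t)\<close>, for
  \<open>w = z\<close> and \<open>w = - z\<close>, yields a smooth substitute for a maximum: with
  the exponentials summed over all blocks, the right side bounds every noise mean at once and has an
  explicit expectation.\<close>

lemma le_plus_exp:
  fixes c :: real
  assumes "c > 0"
  shows "\<bar>z\<bar> \<le> t + exp (- (c * t)) / c * (exp (c * z) + exp (- c * z))"
proof -
  have *: "w \<le> t + exp (- (c * t)) / c * exp (c * w)" for w
  proof -
    have "c * (w - t) \<le> exp (c * (w - t))" using exp_ge_add_one_self[of "c * (w - t)"] by linarith
    then have "w - t \<le> exp (c * (w - t)) / c" using assms by (simp add: field_simps)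
    also have "\<dots> = exp (- (c * t)) / c * exp (c * w)"
      by (simp add: exp_add[symmetric] algebra_simps)
    finally show ?thesis by simp
  qed
  have "z \<le> t + exp (- (c * t)) / c * exp (c * z)" "- z \<le> t + exp (- (c * t)) / c * exp (- c * z)"
    using *[of z] *[of "- z"] by auto
  moreover have "0 \<le> exp (- (c * t)) / c * exp (c * z)" "0 \<le> exp (- (c * t)) / c * exp (- c * z)"
    using assms by auto
  ultimately show ?thesis by (auto simp: distrib_left abs_le_iff)
qed

lemma block_estimator_risk:
  assumes f: "f \<in> holder_class r L" and r: "1 \<le> r" "r \<le> 2" and "0 \<le> L" and "\<sigma> > 0"
    and K: "K > 0" "2 * K \<le> n" and ln: "1 \<le> ln (real n)"
  shows "sup_risk n \<sigma> (block_estimator n K) f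
    \<le> ennreal (54 * L * (real K / real n) powr r + 20 * \<sigma> * sqrt (ln (real n) / K))"
proof -
  define E where "E = (\<Pi>\<^sub>M i\<in>{1..n}. std_normal_distribution)"
  define M where "M = n div K"
  \<comment> \<open>With these \<open>c\<close> and \<open>t\<close>,
    \<open>c * t = 2 * ln n\<close> and each exponential moment is \<open>exp (ln n / 2)\<close>.
    Over at most \<open>n\<close> blocks the exponential terms then cost at most
    \<open>10 / c \<le> 5 * t\<close>, which doubles the deterministic \<open>5 * t\<close> and
    gives the constant 20.\<close>
  define c where "c = sqrt (K * ln n) / \<sigma>"
  define t where "t = 2 * \<sigma> * sqrt (ln n / K)"
  define B where "B = 54 * L * (real K / real n) powr r + 5 * t"
  define Z where "Z j \<epsilon> = block_mean K j (\<lambda>i. \<sigma> * \<epsilon> i)" for j \<epsilon>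
  define T where "T \<epsilon> = (\<lambda>i\<in>{1..n}. f (real i / real n) + \<sigma> * \<epsilon> i)" for \<epsilon> :: "nat \<Rightarrow> real"
  have n: "n > 0" using K by auto
  have c: "c > 0" using K ln \<open>\<sigma> > 0\<close> by (simp add: c_def)
  have t: "t \<ge> 0" using ln \<open>\<sigma> > 0\<close> by (simp add: t_def)
  have B: "B \<ge> 0" using t \<open>0 \<le> L\<close> by (simp add: B_def)
  interpret E: prob_space E unfolding E_def by (rule prob_space_std_normal_PiM)
  have T: "T \<in> E \<rightarrow>\<^sub>M data_space n"
    using measurable_observation[where n=n and f=f and \<sigma>=\<sigma>] by (simp add: T_def[abs_def] E_def)
  have loss: "(\<lambda>y. sup_norm01 (\<lambda>x. block_estimator n K y x - f x)) \<in> borel_measurable (data_space n)"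
    using block_estimator_estimators[OF K, of "{f}"] by (simp add: estimators_def)
  have Zm[measurable]: "Z j \<in> borel_measurable E" if "j < M" for j
  proof -
    have "block K j \<subseteq> {1..n}" using block_subset that by (simp add: M_def)
    then show ?thesis unfolding Z_def block_mean_def E_def by (auto intro!: borel_measurable_sum
      borel_measurable_divide borel_measurable_times measurable_component_singleton[where M="\<lambda>_. std_normal_distribution", simplified] simp del: One_nat_def)
  qed
  define q where "q = 5 * (exp (- (c * t)) / c)"
  have q: "q \<ge> 0" using c by (simp add: q_def)
  have "sup_risk n \<sigma> (block_estimator n K) f
      = (\<integral>\<^sup>+ \<epsilon>. sup_norm01 (\<lambda>x. block_estimator n K (T \<epsilon>) x - f x) \<partial>E)"
    unfolding sup_risk_def data_law_def
    using nn_integral_distr[OF T, of "\<lambda>y. sup_norm01 (\<lambda>x. block_estimator n K y x - f x)"] loss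
    by (simp add: T_def[abs_def] E_def)
  also have "\<dots> \<le> (\<integral>\<^sup>+ \<epsilon>. ennreal B + ennreal q *
      (\<Sum>j<M. ennreal (exp (c * Z j \<epsilon>)) + ennreal (exp (- c * Z j \<epsilon>))) \<partial>E)"
  proof (intro nn_integral_mono)
    fix \<epsilon>
    define S where "S = (\<Sum>j<M. exp (c * Z j \<epsilon>) + exp (- c * Z j \<epsilon>))"
    have S: "S \<ge> 0" by (auto simp: S_def intro!: sum_nonneg add_nonneg_nonneg)
    have "\<bar>block_estimator n K (T \<epsilon>) x - f x\<bar> \<le> B + q * S" if x: "x \<in> {0..1}" for x
    proof -
      have "\<bar>block_estimator n K (T \<epsilon>) x - f x\<bar>
          \<le> 54 * L * (real K / real n) powr r + 5 * (t + exp (- (c * t)) / c * S)"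
      proof (rule block_estimator_error[OF f r \<open>0 \<le> L\<close> K x])
        fix j assume j: "j < n div K"
        have "\<bar>Z j \<epsilon>\<bar> \<le> t + exp (- (c * t)) / c * (exp (c * Z j \<epsilon>) + exp (- c * Z j \<epsilon>))"
          by (rule le_plus_exp[OF c])
        also have "\<dots> \<le> t + exp (- (c * t)) / c * S"
          unfolding S_def using j c
          by (intro add_left_mono mult_left_mono member_le_sum[of j "{..<M}" "\<lambda>j. exp (c * Z j \<epsilon>) + exp (- c * Z j \<epsilon>)"])
             (auto simp: M_def)
        finally show "\<bar>block_mean K j (\<lambda>i. \<sigma> * \<epsilon> i)\<bar> \<le> t + exp (- (c * t)) / c * S" by (simp add: Z_def)
      qed (auto simp: T_def)
      then show ?thesis by (simp add: B_def q_def algebra_simps)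
    qed
    then have "sup_norm01 (\<lambda>x. block_estimator n K (T \<epsilon>) x - f x) \<le> ennreal (B + q * S)"
      unfolding sup_norm01_def by (intro SUP_least ennreal_leI)
    also have "\<dots> = ennreal B + ennreal q * ennreal S"
      using B q S by (simp add: ennreal_mult)
    also have "ennreal S = (\<Sum>j<M. ennreal (exp (c * Z j \<epsilon>)) + ennreal (exp (- c * Z j \<epsilon>)))"
      by (simp add: S_def ennreal_plus[symmetric] sum_ennreal del: ennreal_plus)
    finally show "sup_norm01 (\<lambda>x. block_estimator n K (T \<epsilon>) x - f x) \<le> ennreal B + ennreal q *
      (\<Sum>j<M. ennreal (exp (c * Z j \<epsilon>)) + ennreal (exp (- c * Z j \<epsilon>)))" .
  qed
  also have "\<dots> = ennreal B + ennreal q * (\<Sum>j<M. (\<integral>\<^sup>+ \<epsilon>. ennreal (exp (c * Z j \<epsilon>)) \<partial>E) +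
      (\<integral>\<^sup>+ \<epsilon>. ennreal (exp (- c * Z j \<epsilon>)) \<partial>E))"
  proof -
    have [measurable]: "(\<lambda>\<epsilon>. ennreal (exp (d * Z j \<epsilon>))) \<in> borel_measurable E" if "j < M" for j d
      using Zm[OF that] by measurable
    show ?thesis
      by (subst nn_integral_add, simp, simp, subst nn_integral_cmult, simp, subst nn_integral_sum, simp)
         (simp add: nn_integral_add E.emeasure_space_1)
  qed
  also have "\<dots> = ennreal B + ennreal q * (\<Sum>j<M. ennreal (2 * exp (c\<^sup>2 * \<sigma>\<^sup>2 / (2 * K))))"
  proof -
    have "(\<integral>\<^sup>+ \<epsilon>. ennreal (exp (d * Z j \<epsilon>)) \<partial>E) = ennreal (exp (d\<^sup>2 * \<sigma>\<^sup>2 / (2 * K)))" if "j < M" for j d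
      unfolding E_def Z_def by (rule nn_integral_exp_block_mean) (use K that in \<open>auto simp: M_def\<close>)
    from this[of _ c] this[of _ "- c"]
    have "(\<integral>\<^sup>+ \<epsilon>. ennreal (exp (c * Z j \<epsilon>)) \<partial>E) + (\<integral>\<^sup>+ \<epsilon>. ennreal (exp (- c * Z j \<epsilon>)) \<partial>E)
        = ennreal (2 * exp (c\<^sup>2 * \<sigma>\<^sup>2 / (2 * K)))" if "j < M" for j
      using that by (simp only: power2_minus mult_2) (subst ennreal_plus, auto)
    then show ?thesis by simp
  qed
  also have "\<dots> = ennreal (B + q * (M * (2 * exp (c\<^sup>2 * \<sigma>\<^sup>2 / (2 * K)))))"
    using B q by (simp add: ennreal_mult ennreal_of_nat_eq_real_of_nat)
  also have "\<dots> \<le> ennreal (54 * L * (real K / real n) powr r + 20 * \<sigma> * sqrt (ln (real n) / K))"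
  proof (rule ennreal_leI)
    have "c * t = 2 * (sqrt (K * ln n) * sqrt (ln n / K))"
      using \<open>\<sigma> > 0\<close> by (simp add: c_def t_def)
    also have "sqrt (K * ln n) * sqrt (ln n / K) = ln n"
      using K ln by (simp add: real_sqrt_mult[symmetric])
    finally have ct: "c * t = 2 * ln n" .
    have c2: "c\<^sup>2 * \<sigma>\<^sup>2 / (2 * K) = ln n / 2"
      using K ln \<open>\<sigma> > 0\<close> by (simp add: c_def power_divide)
    have "exp (- (2 * ln n)) * exp (ln n / 2) * real n = exp (- (2 * ln n) + ln n / 2 + ln n)"
      using n by (simp only: exp_add) simp
    also have "\<dots> \<le> 1" using ln by simp
    finally have e1: "exp (- (2 * ln n)) * exp (ln n / 2) * real n \<le> 1" .
    have "1 / c = \<sigma> * (1 / sqrt (K * ln n))" by (simp add: c_def)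
    also have "1 / sqrt (K * ln n) \<le> sqrt (ln n / K)"
    proof -
      have "1 / ln n \<le> ln n" using mult_mono[OF ln ln] ln by (simp add: pos_divide_le_eq)
      then have "1 / ln n / K \<le> ln n / K" by (intro divide_right_mono) auto
      then have "sqrt (1 / (K * ln n)) \<le> sqrt (ln n / K)" by (intro real_sqrt_le_mono) (simp add: mult.commute)
      then show ?thesis by (simp add: real_sqrt_divide)
    qed
    finally have c1: "1 / c \<le> \<sigma> * sqrt (ln n / K)" using \<open>\<sigma> > 0\<close> by simp
    have "q * (M * (2 * exp (c\<^sup>2 * \<sigma>\<^sup>2 / (2 * K)))) = 10 * (1 / c) * (exp (- (2 * ln n)) * exp (ln n / 2) * M)"
      unfolding c2 q_def ct by simp
    also have "\<dots> \<le> 10 * (1 / c) * (exp (- (2 * ln n)) * exp (ln n / 2) * n)"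
      using c by (intro mult_left_mono) (auto simp: M_def)
    also have "\<dots> \<le> 10 * (1 / c) * 1" using c e1 by (intro mult_left_mono) auto
    also have "\<dots> \<le> 10 * (\<sigma> * sqrt (ln n / K))" using c1 by simp
    finally show "B + q * (M * (2 * exp (c\<^sup>2 * \<sigma>\<^sup>2 / (2 * K))))
        \<le> 54 * L * (real K / real n) powr r + 20 * \<sigma> * sqrt (ln (real n) / K)"
      by (simp add: B_def t_def)
  qed
  finally show ?thesis .
qed

subsection \<open>Least favourable convex functions\<close>

lemma DERIV_max_0_square: "((\<lambda>x::real. (max 0 x)\<^sup>2) has_real_derivative 2 * max 0 x) (at x)"
proof -
  consider "x > 0" | "x < 0" | "x = 0" by linarith
  then show ?thesis
  proof cases
    case 1
    show ?thesis
      by (rule has_field_derivative_transform_within_open[of "\<lambda>x. x\<^sup>2" _ _ "{0<..}"])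
         (use 1 in \<open>auto intro!: derivative_eq_intros\<close>)
  next
    case 2
    show ?thesis
      by (rule has_field_derivative_transform_within_open[of "\<lambda>_. 0" _ _ "{..<0}"])
         (use 2 in \<open>auto intro!: derivative_eq_intros\<close>)
  next
    case 3
    have "((\<lambda>h::real. (max 0 h)\<^sup>2 / h) \<longlongrightarrow> 0) (at 0)"
    proof (rule Lim_null_comparison)
      show "\<forall>\<^sub>F h in at 0. norm ((max 0 h)\<^sup>2 / h) \<le> \<bar>h\<bar>"
        by (rule always_eventually) (auto simp: max_def power2_eq_square)
      show "((\<lambda>h::real. \<bar>h\<bar>) \<longlongrightarrow> 0) (at 0)" by (rule tendsto_rabs_zero[OF tendsto_ident_at])
    qed
    then show ?thesis using 3 by (simp add: DERIV_def)
  qed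
qed

text \<open>For \<open>b < 1 / 2\<close> this rises linearly from 0 to 1 on
  \<open>[b, 1 - b]\<close> and is constant elsewhere. Positive parts give the primitive
  \<open>ramp_integral\<close> in closed form.\<close>

definition ramp :: "real \<Rightarrow> real \<Rightarrow> real" where
  "ramp b u = (max 0 (u - b) - max 0 (u - (1 - b))) / (1 - 2 * b)"

definition ramp_integral :: "real \<Rightarrow> real \<Rightarrow> real" where
  "ramp_integral b u = ((max 0 (u - b))\<^sup>2 - (max 0 (u - (1 - b)))\<^sup>2) / (2 * (1 - 2 * b))"

lemma DERIV_ramp_integral:
  "(ramp_integral b has_real_derivative ramp b u) (at u)"
proof -
  have "((\<lambda>u. (max 0 (u - a))\<^sup>2) has_real_derivative 2 * max 0 (u - a)) (at u)" for a
    by (rule DERIV_cong[OF DERIV_chain2[OF DERIV_max_0_square, where g = "\<lambda>u. u - a"]])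
       (auto intro!: derivative_eq_intros)
  from DERIV_cdivide[OF DERIV_diff[OF this[of b] this[of "1 - b"]], of "2 * (1 - 2 * b)"]
  show ?thesis
    unfolding ramp_integral_def[abs_def] ramp_def
    by (rule DERIV_cong) (simp only: right_diff_distrib[symmetric] mult_divide_mult_cancel_left_if, simp)
qed

lemma ramp_eq:
  assumes "0 \<le> b" "b \<le> 1 / 4"
  shows "ramp b u = max 0 (min 1 ((u - b) / (1 - 2 * b)))"
  using assms by (auto simp: ramp_def max_def min_def field_simps)

lemma ramp_bounds:
  assumes "0 \<le> b" "b \<le> 1 / 4"
  shows "0 \<le> ramp b u" "ramp b u \<le> 1"
  using assms by (auto simp: ramp_eq)

lemma ramp_le_0: "0 \<le> b \<Longrightarrow> b \<le> 1 / 4 \<Longrightarrow> u \<le> 0 \<Longrightarrow> ramp b u = 0"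
  and ramp_ge_1: "0 \<le> b \<Longrightarrow> b \<le> 1 / 4 \<Longrightarrow> 1 \<le> u \<Longrightarrow> ramp b u = 1"
  by (auto simp: ramp_def max_def field_simps)

lemma ramp_mono:
  assumes "0 \<le> b" "b \<le> 1 / 4" "u \<le> v"
  shows "ramp b u \<le> ramp b v"
proof -
  have "(u - b) / (1 - 2 * b) \<le> (v - b) / (1 - 2 * b)" using assms by (intro divide_right_mono) auto
  then show ?thesis using assms by (auto simp: ramp_eq max_def min_def)
qed

text \<open>The slope on the rising part is \<open>1 / (1 - 2 * b)\<close>, at most 2, and clamping
  to [0, 1] does not enlarge increments.\<close>

lemma ramp_lipschitz:
  assumes "0 \<le> b" "b \<le> 1 / 4" "u \<le> v"
  shows "ramp b v - ramp b u \<le> 2 * (v - u)"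
proof -
  have "(v - b) / (1 - 2 * b) - (u - b) / (1 - 2 * b) = (v - u) / (1 - 2 * b)"
    by (simp add: diff_divide_distrib)
  also have "\<dots> \<le> (v - u) / (1 / 2)" using assms by (intro divide_left_mono) auto
  finally have *: "(v - b) / (1 - 2 * b) - (u - b) / (1 - 2 * b) \<le> 2 * (v - u)" by simp
  have "max 0 (min 1 q) - max 0 (min 1 p) \<le> 2 * (v - u)" if "q - p \<le> 2 * (v - u)" for p q
    using that \<open>u \<le> v\<close> by (auto simp: max_def min_def)
  from this[OF *] show ?thesis by (simp only: ramp_eq[OF assms(1,2)])
qed

text \<open>The change in height when a climb spread over the unit interval is concentrated on its
  middle half.\<close>

definition bump :: "real \<Rightarrow> real" where
  "bump u = ramp_integral (1 / 4) u - ramp_integral 0 u"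

text \<open>Both ramps are symmetric about 1/2, so from 1 onwards both primitives equal
  \<open>u - 1 / 2\<close>; up to 0 both vanish.\<close>

lemma bump_outside: "u \<le> 0 \<or> 1 \<le> u \<Longrightarrow> bump u = 0"
  by (auto simp: bump_def ramp_integral_def max_def power2_eq_square field_simps)

lemma bump_half: "bump (1 / 2) = - 1 / 16"
  by (simp add: bump_def ramp_integral_def power2_eq_square)

text \<open>On the unit interval both primitives take values in [0, 1/2].\<close>

lemma abs_bump_le: "\<bar>bump u\<bar> \<le> 1 / 2"
proof (cases "u \<le> 0 \<or> 1 \<le> u")
  case False
  have quarter: "(max 0 (u - 1 / 4))\<^sup>2 - (max 0 (u - 3 / 4))\<^sup>2 \<le> 1 / 2"
  proof (cases "u \<le> 3 / 4")
    case True
    then have "(max 0 (u - 1 / 4))\<^sup>2 \<le> (1 / 2)\<^sup>2" by (intro power_mono) (auto simp: max_def)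
    then show ?thesis using True by (simp add: power_divide)
  next
    case F: False
    then show ?thesis using False by (simp add: power2_eq_square algebra_simps)
  qed
  have "(max 0 (u - 3 / 4))\<^sup>2 \<le> (max 0 (u - 1 / 4))\<^sup>2" by (intro power_mono) auto
  with quarter have "0 \<le> ramp_integral (1 / 4) u" "ramp_integral (1 / 4) u \<le> 1 / 2"
    by (auto simp: ramp_integral_def)
  moreover have "ramp_integral 0 u = u\<^sup>2 / 2" using False by (simp add: ramp_integral_def max_def)
  moreover have "0 \<le> u\<^sup>2" "u\<^sup>2 \<le> 1" using False by (auto intro: power_le_one)
  ultimately show ?thesis unfolding bump_def abs_le_iff by linarith
qed (simp add: bump_outside)

text \<open>Serves to count both the climbs that meet an interval and the design points under a
  bump.\<close>

lemma card_nat_between: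
  fixes a b :: real
  assumes "a \<le> b"
  shows "finite {k::nat. a < k \<and> k < b}" "real (card {k::nat. a < k \<and> k < b}) \<le> b - a + 1"
proof -
  let ?S = "{k::nat. a < k \<and> k < b}"
  have sub: "int ` ?S \<subseteq> {\<lfloor>a\<rfloor> + 1..\<lceil>b\<rceil> - 1}"
    by (auto simp: less_ceiling_iff floor_less_iff) linarith+
  then have "finite (int ` ?S)" by (rule finite_subset) simp
  then show "finite ?S" by (rule finite_imageD) simp
  have "card ?S = card (int ` ?S)" by (simp add: card_image)
  also have "\<dots> \<le> card {\<lfloor>a\<rfloor> + 1..\<lceil>b\<rceil> - 1}" using sub by (intro card_mono) auto
  also have "\<dots> = nat (\<lceil>b\<rceil> - 1 - \<lfloor>a\<rfloor>)" by simp
  finally have "real (card ?S) \<le> real (nat (\<lceil>b\<rceil> - 1 - \<lfloor>a\<rfloor>))" by (rule of_nat_mono)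
  also have "\<dots> \<le> b - a + 1" using assms by linarith
  finally show "real (card ?S) \<le> b - a + 1" .
qed

text \<open>The slope of \<open>hypothesis M h \<delta> j\<close> climbs by \<open>\<delta>\<close> on each interval \<open>[k / M, k / M + h]\<close>, more
  abruptly for \<open>k = j\<close>; for \<open>j \<ge> M\<close> no interval is distinguished.  When \<open>r < 2\<close> the total slope
  \<open>M * \<delta>\<close> available to a member of the class only allows intervals that fill a vanishing part of
  \<open>[0, 1]\<close>, but their number is still a power of \<open>1 / h\<close>.\<close>

definition hypothesis :: "nat \<Rightarrow> real \<Rightarrow> real \<Rightarrow> nat \<Rightarrow> real \<Rightarrow> real" where
  "hypothesis M h \<delta> j x =
    \<delta> * h * (\<Sum>k<M. ramp_integral (if k = j then 1 / 4 else 0) ((x - real k / real M) / h))"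

definition hypothesis_slope :: "nat \<Rightarrow> real \<Rightarrow> real \<Rightarrow> nat \<Rightarrow> real \<Rightarrow> real" where
  "hypothesis_slope M h \<delta> j x =
    \<delta> * (\<Sum>k<M. ramp (if k = j then 1 / 4 else 0) ((x - real k / real M) / h))"

lemma DERIV_hypothesis:
  assumes "h > 0"
  shows "(hypothesis M h \<delta> j has_real_derivative hypothesis_slope M h \<delta> j x) (at x)"
proof -
  have "((\<lambda>x. ramp_integral b ((x - a) / h)) has_real_derivative ramp b ((x - a) / h) * (1 / h)) (at x)" for a b
    by (rule DERIV_chain2[OF DERIV_ramp_integral]) (use assms in \<open>auto intro!: derivative_eq_intros\<close>)
  then have "((\<lambda>x. \<delta> * h * (\<Sum>k<M. ramp_integral (if k = j then 1 / 4 else 0) ((x - real k / real M) / h)))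
      has_real_derivative
      \<delta> * h * (\<Sum>k<M. ramp (if k = j then 1 / 4 else 0) ((x - real k / real M) / h) * (1 / h))) (at x)"
    by (intro DERIV_cmult DERIV_sum)
  then show ?thesis
    using assms by (simp add: hypothesis_def[abs_def] hypothesis_slope_def sum_divide_distrib[symmetric])
qed

section \<open>Membership in the convex Hoelder class\<close>

lemma hypothesis_slope_mono:
  assumes "h > 0" "\<delta> \<ge> 0" "x \<le> y"
  shows "hypothesis_slope M h \<delta> j x \<le> hypothesis_slope M h \<delta> j y"
  unfolding hypothesis_slope_def using assms
  by (intro mult_left_mono sum_mono ramp_mono divide_right_mono) auto

text \<open>Only climbs that meet the open interval from \<open>x\<close> to \<open>y\<close>
  contribute, which confines \<open>k\<close> to \<open>?S\<close>; as \<open>M * h \<le> 1\<close>,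
  this leaves at most \<open>M * (y - x) + 2\<close> indices. Each ramp grows by at most its range 1
  and by at most its Lipschitz bound.\<close>

lemma hypothesis_slope_increment:
  assumes h: "h > 0" and M: "M > 0" "real M * h \<le> 1" and "\<delta> \<ge> 0" and xy: "x \<le> y"
  shows "hypothesis_slope M h \<delta> j y - hypothesis_slope M h \<delta> j x
    \<le> \<delta> * ((M * (y - x) + 2) * min 1 (2 * ((y - x) / h)))"
proof -
  let ?b = "\<lambda>k. if k = j then 1 / 4 else 0 :: real"
  let ?u = "\<lambda>k x. (x - real k / real M) / h"
  let ?S = "{k::nat. M * (x - h) < k \<and> k < M * y}"
  let ?m = "min 1 (2 * ((y - x) / h))"
  have m: "?m \<ge> 0" using h xy by simp
  have le: "M * (x - h) \<le> M * y" using h xy by (intro mult_left_mono) auto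
  have "(\<Sum>k<M. ramp (?b k) (?u k y)) - (\<Sum>k<M. ramp (?b k) (?u k x))
      = (\<Sum>k<M. ramp (?b k) (?u k y) - ramp (?b k) (?u k x))"
    by (simp add: sum_subtractf)
  also have "\<dots> \<le> (\<Sum>k<M. if k \<in> ?S then ?m else 0)"
  proof (intro sum_mono)
    fix k
    show "ramp (?b k) (?u k y) - ramp (?b k) (?u k x) \<le> (if k \<in> ?S then ?m else 0)"
    proof (cases "k \<in> ?S")
      case True
      have "ramp (?b k) (?u k y) - ramp (?b k) (?u k x) \<le> 2 * (?u k y - ?u k x)"
        using h xy by (intro ramp_lipschitz divide_right_mono) auto
      also have "\<dots> = 2 * ((y - x) / h)" by (simp add: diff_divide_distrib[symmetric])
      finally have "ramp (?b k) (?u k y) - ramp (?b k) (?u k x) \<le> 2 * ((y - x) / h)" .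
      moreover have "ramp (?b k) (?u k y) - ramp (?b k) (?u k x) \<le> 1"
        using ramp_bounds[of "?b k" "?u k y"] ramp_bounds[of "?b k" "?u k x"] by auto
      ultimately show ?thesis using True by simp
    next
      case False
      then consider "k \<le> M * (x - h)" | "M * y \<le> k" by force
      then show ?thesis
      proof cases
        case 1
        then have "real k / M \<le> x - h" using M by (simp add: field_simps)
        then have "1 \<le> ?u k x" "1 \<le> ?u k y" using h xy by (auto simp: field_simps)
        then show ?thesis by (simp add: ramp_ge_1 if_not_P[OF False] del: mem_Collect_eq)
      next
        case 2
        then have "y \<le> real k / M" using M by (simp add: field_simps)
        then have "?u k x \<le> 0" "?u k y \<le> 0" using h xy by (auto simp: divide_nonpos_pos)
        then show ?thesis by (simp add: ramp_le_0 if_not_P[OF False] del: mem_Collect_eq)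
      qed
    qed
  qed
  also have "\<dots> = (\<Sum>k\<in>{..<M} \<inter> ?S. ?m)" by (simp only: sum.inter_restrict[OF finite_lessThan])
  also have "\<dots> = card ({..<M} \<inter> ?S) * ?m" by simp
  also have "\<dots> \<le> card ?S * ?m"
    using m card_nat_between(1)[OF le] by (intro mult_right_mono of_nat_mono card_mono) auto
  also have "\<dots> \<le> (M * y - M * (x - h) + 1) * ?m"
    by (intro mult_right_mono card_nat_between(2)[OF le] m)
  also have "\<dots> \<le> (M * (y - x) + 2) * ?m"
    using M(2) by (intro mult_right_mono m) (simp add: algebra_simps)
  finally show ?thesis
    using \<open>\<delta> \<ge> 0\<close> by (simp only: hypothesis_slope_def right_diff_distrib[symmetric] mult_left_mono)
qed

text \<open>Convexity is monotonicity of the slope. In the increment over a distance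
  \<open>d\<close>, the term proportional to \<open>M * d\<close> is at most
  \<open>d powr (r - 1)\<close> by the slope budget \<open>M * h powr (r - 1) \<le> 1\<close>, and
  the two extra climbs cost at most \<open>4 * d powr (r - 1)\<close>, up to the factor
  \<open>c\<close>; hence the 5.\<close>

lemma hypothesis_in_class:
  assumes r: "1 < r" "r \<le> 2" and h: "0 < h" "h \<le> 1" and M: "M > 0" "real M * h powr (r - 1) \<le> 1"
    and c: "0 \<le> c" "5 * c \<le> L"
  shows "hypothesis M h (c * h powr (r - 1)) j \<in> convex_holder_class r L"
proof -
  let ?f = "hypothesis M h (c * h powr (r - 1)) j"
  let ?g = "hypothesis_slope M h (c * h powr (r - 1)) j"
  have "h powr 1 \<le> h powr (r - 1)" using h r by (intro powr_mono') auto
  then have "real M * h \<le> real M * h powr (r - 1)" using h by (intro mult_left_mono) auto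
  with M(2) have Mh: "real M * h \<le> 1" by (rule order_trans[rotated])
  have der: "(?f has_real_derivative ?g x) (at x)" for x by (rule DERIV_hypothesis[OF h(1)])
  have d01: "deriv01 ?f x = ?g x" if "x \<in> {0..1}" for x
    unfolding deriv01_def using der[of x] that
    by (intro vector_derivative_at_within_ivl) (auto simp: has_real_derivative_iff_has_vector_derivative)
  have diff: "?f differentiable_on {0..1}"
    unfolding differentiable_on_def real_differentiable_def using der
    by (meson has_field_derivative_at_within real_differentiable_def)
  have mono: "?g x \<le> ?g y" if "x \<le> y" for x y
    using that c h by (intro hypothesis_slope_mono) auto
  have "convex_on {0..1} ?f" by (rule convex_on_realI[OF _ der mono]) auto
  moreover have "continuous_on {0..1} ?f" by (rule differentiable_imp_continuous_on[OF diff])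
  moreover have "(?g x - ?g y) * (x - y) \<ge> 0" for x y
    using mono[of x y] mono[of y x] by (cases "x \<le> y") (auto simp: zero_le_mult_iff)
  ultimately have conv: "?f \<in> convex_class" by (auto simp: convex_class_def diff d01)
  have inc: "?g y - ?g x \<le> L * (y - x) powr (r - 1)" if xy: "0 \<le> x" "x < y" "y \<le> 1" for x y
  proof -
    define d where "d = y - x"
    have d: "0 < d" "d \<le> 1" using xy by (auto simp: d_def)
    let ?m = "min 1 (2 * (d / h))"
    have m: "0 \<le> ?m" "?m \<le> 1" using d h by auto
    \<comment> \<open>For \<open>h \<le> d\<close> this rests on \<open>r \<ge> 1\<close>; for
      \<open>d < h\<close> it rests on \<open>r \<le> 2\<close>, which gives
      \<open>h powr (r - 2) \<le> d powr (r - 2)\<close>.\<close>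
    have 1: "h powr (r - 1) * ?m \<le> 2 * d powr (r - 1)"
    proof (cases "h \<le> d")
      case True
      have "h powr (r - 1) * ?m \<le> h powr (r - 1) * 1" using m by (intro mult_left_mono) auto
      also have "\<dots> \<le> d powr (r - 1)" using True h r by (simp add: powr_mono2)
      finally show ?thesis using powr_ge_zero[of d "r - 1"] by linarith
    next
      case False
      have "h powr (r - 1) * ?m \<le> h powr (r - 1) * (2 * (d / h))" by (intro mult_left_mono) auto
      also have "\<dots> = 2 * (d * h powr (r - 2))"
        using h powr_diff[of h "r - 1" 1] by simp
      also have "h powr (r - 2) \<le> d powr (r - 2)" using False d r by (intro powr_mono2') auto
      also have "d * d powr (r - 2) = d powr (r - 1)"
        using d powr_add[of d 1 "r - 2"] by simp
      finally show ?thesis using d by (simp add: mult_left_mono)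
    qed
    have "d powr 1 \<le> d powr (r - 1)" using d r by (intro powr_mono') auto
    then have 2: "d \<le> d powr (r - 1)" using d by simp
    have "?g y - ?g x \<le> c * h powr (r - 1) * ((M * d + 2) * ?m)"
      unfolding d_def using xy c by (intro hypothesis_slope_increment h M Mh) auto
    also have "\<dots> = c * (M * h powr (r - 1) * (d * ?m) + 2 * (h powr (r - 1) * ?m))"
      by (simp add: algebra_simps)
    also have "\<dots> \<le> c * (5 * d powr (r - 1))"
    proof (intro mult_left_mono)
      have "M * h powr (r - 1) * (d * ?m) \<le> 1 * (d powr (r - 1) * 1)"
        using M 2 m d by (intro mult_mono) auto
      with 1 show "M * h powr (r - 1) * (d * ?m) + 2 * (h powr (r - 1) * ?m) \<le> 5 * d powr (r - 1)"
        by linarith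
    qed (use c in simp)
    also have "\<dots> = (5 * c) * d powr (r - 1)" by simp
    also have "\<dots> \<le> L * d powr (r - 1)" using c by (intro mult_right_mono) auto
    finally show ?thesis by (simp add: d_def)
  qed
  have "\<bar>?g x - ?g y\<bar> \<le> L * \<bar>x - y\<bar> powr (r - 1)" if "x \<in> {0..1}" "y \<in> {0..1}" for x y
  proof -
    consider "x < y" | "y < x" | "x = y" by linarith
    then show ?thesis
    proof cases
      case 1
      then show ?thesis using inc[of x y] mono[of x y] that by (simp add: abs_minus_commute)
    next
      case 2
      then show ?thesis using inc[of y x] mono[of y x] that by simp
    qed simp
  qed
  then have "?f \<in> holder_class r L" by (auto simp: holder_class_def diff d01)
  with conv show ?thesis by (simp add: convex_holder_class_def)
qed

section \<open>Separation and distance of the hypotheses\<close>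

lemma hypothesis_minus_base:
  assumes "j < M"
  shows "hypothesis M h \<delta> j x - hypothesis M h \<delta> M x = \<delta> * h * bump ((x - real j / real M) / h)"
proof -
  have "(\<Sum>k<M. ramp_integral (if k = j then 1 / 4 else 0) ((x - real k / real M) / h)) -
      (\<Sum>k<M. ramp_integral (if k = M then 1 / 4 else 0) ((x - real k / real M) / h))
    = (\<Sum>k<M. if j = k then bump ((x - real k / real M) / h) else 0)"
    unfolding sum_subtractf[symmetric] by (intro sum.cong) (auto simp: bump_def)
  also have "\<dots> = bump ((x - real j / real M) / h)" using assms by simp
  finally show ?thesis by (simp add: hypothesis_def right_diff_distrib[symmetric])
qed

lemma hypothesis_separated:
  assumes "j < M" "k < M" "j \<noteq> k" and h: "0 < h" and M: "real M * h \<le> 1" and "\<delta> \<ge> 0"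
  shows "\<exists>x\<in>{0..1}. \<delta> * h / 16 \<le> \<bar>hypothesis M h \<delta> j x - hypothesis M h \<delta> k x\<bar>"
proof -
  \<comment> \<open>The midpoint of the \<open>j\<close>-th climb, where its bump is -1/16. The
    climbs do not overlap because \<open>M * h \<le> 1\<close>, so the \<open>k\<close>-th bump
    vanishes there.\<close>
  define x where "x = real j / M + h / 2"
  have M0: "real M > 0" using assms by simp
  have hM: "h \<le> 1 / M" using M M0 by (simp add: field_simps)
  have "real j + 1 \<le> real M" using assms(1) by linarith
  then have "real j / M + 1 / M \<le> 1" using M0 by (simp add: add_divide_distrib[symmetric])
  with hM h have x01: "x \<in> {0..1}" by (auto simp: x_def)
  have uj: "(x - real j / M) / h = 1 / 2" using h by (simp add: x_def)
  have "bump ((x - real k / M) / h) = 0"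
  proof (cases "k < j")
    case True
    then have "real k + 1 \<le> j" by linarith
    then have "real k / M + 1 / M \<le> real j / M"
      using M0 by (simp add: add_divide_distrib[symmetric] divide_right_mono)
    then have "h \<le> x - real k / M" unfolding x_def using hM h by linarith
    then show ?thesis using h by (intro bump_outside disjI2) (simp add: pos_le_divide_eq)
  next
    case False
    then have "real j + 1 \<le> k" using assms(3) by linarith
    then have "real j / M + 1 / M \<le> real k / M"
      using M0 by (simp add: add_divide_distrib[symmetric] divide_right_mono)
    then show ?thesis using hM h by (intro bump_outside disjI1 divide_nonpos_pos) (auto simp: x_def)
  qed
  then have "hypothesis M h \<delta> j x - hypothesis M h \<delta> k x = - (\<delta> * h / 16)"
    using hypothesis_minus_base[OF assms(1), of h \<delta> x] hypothesis_minus_base[OF assms(2), of h \<delta> x]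
    by (simp add: uj bump_half)
  then show ?thesis using x01 h \<open>\<delta> \<ge> 0\<close> by (intro bexI[of _ x]) auto
qed

text \<open>The bump covers at most \<open>n * h + 1 \<le> 2 * n * h\<close> design points, each
  contributing at most \<open>(\<delta> * h / (2 * \<sigma>))\<^sup>2\<close>. The sum is the
  logarithm of the second moment of the likelihood ratio.\<close>

lemma hypothesis_distance:
  assumes "j < M" and h: "0 < h" "1 \<le> real n * h" and "\<sigma> > 0"
  shows "(\<Sum>i\<in>{1..n}. ((hypothesis M h \<delta> j (real i / real n) - hypothesis M h \<delta> M (real i / real n)) / \<sigma>)\<^sup>2)
    \<le> n * h ^ 3 * \<delta>\<^sup>2 / (2 * \<sigma>\<^sup>2)"
proof -
  define a where "a = real n * (real j / real M)"
  let ?S = "{i::nat. a < i \<and> i < a + n * h}"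
  let ?m = "(\<delta> * h / (2 * \<sigma>))\<^sup>2"
  have n: "n > 0" using h by (cases n) auto
  have le: "a \<le> a + n * h" using h by simp
  have "(\<Sum>i\<in>{1..n}. ((hypothesis M h \<delta> j (real i / real n) - hypothesis M h \<delta> M (real i / real n)) / \<sigma>)\<^sup>2)
      \<le> (\<Sum>i\<in>{1..n}. if i \<in> ?S then ?m else 0)"
  proof (intro sum_mono)
    fix i
    let ?u = "(real i / real n - real j / real M) / h"
    have "(\<delta> * h * bump ?u / \<sigma>)\<^sup>2 = (\<delta> * h / \<sigma>)\<^sup>2 * (bump ?u)\<^sup>2"
      by (simp add: power_mult_distrib power_divide)
    also have "\<dots> \<le> (if i \<in> ?S then ?m else 0)"
    proof (cases "i \<in> ?S")
      case True
      have "(bump ?u)\<^sup>2 \<le> (1 / 2)\<^sup>2" using abs_bump_le by (intro abs_le_square_iff[THEN iffD1]) simp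
      then have "(\<delta> * h / \<sigma>)\<^sup>2 * (bump ?u)\<^sup>2 \<le> (\<delta> * h / \<sigma>)\<^sup>2 * (1 / 2)\<^sup>2" by (intro mult_left_mono) auto
      also have "\<dots> = ?m" by (simp add: power_mult_distrib power_divide)
      finally show ?thesis using True by simp
    next
      case False
      then consider "real i \<le> a" | "a + n * h \<le> real i" by force
      then have "?u \<le> 0 \<or> 1 \<le> ?u"
      proof cases
        case 1
        then have "real i / n \<le> real j / M" using n by (simp add: a_def pos_divide_le_eq mult.commute)
        then show ?thesis using h by (simp add: divide_nonpos_pos)
      next
        case 2
        then have "n * (real j / M + h) \<le> real i" by (simp add: a_def distrib_left)
        then have "real j / M + h \<le> real i / n" using n by (simp add: pos_le_divide_eq mult.commute)
        then show ?thesis using h by (simp add: pos_le_divide_eq)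
      qed
      then show ?thesis using False by (simp add: bump_outside)
    qed
    finally show "((hypothesis M h \<delta> j (real i / real n) - hypothesis M h \<delta> M (real i / real n)) / \<sigma>)\<^sup>2
      \<le> (if i \<in> ?S then ?m else 0)"
      by (simp only: hypothesis_minus_base[OF assms(1)])
  qed
  also have "\<dots> = (\<Sum>i\<in>{1..n} \<inter> ?S. ?m)" by (simp only: sum.inter_restrict[OF finite_atLeastAtMost])
  also have "\<dots> = card ({1..n} \<inter> ?S) * ?m" by simp
  also have "\<dots> \<le> card ?S * ?m"
    using card_nat_between(1)[OF le] by (intro mult_right_mono of_nat_mono card_mono) auto
  also have "\<dots> \<le> (a + n * h - a + 1) * ?m"
    by (intro mult_right_mono card_nat_between(2)[OF le]) simp
  also have "\<dots> \<le> (2 * (n * h)) * ?m"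
    by (intro mult_right_mono) (use h in linarith, simp)
  also have "\<dots> = n * h ^ 3 * \<delta>\<^sup>2 / (2 * \<sigma>\<^sup>2)"
    by (simp add: power_divide power_mult_distrib power2_eq_square power3_eq_cube)
  finally show ?thesis .
qed

subsection \<open>The minimax rate\<close>

lemma powr_double_plus_1:
  fixes h :: real
  assumes "h > 0"
  shows "h powr (2 * r + 1) = (h powr r)\<^sup>2 * h"
proof -
  have "(h powr r)\<^sup>2 = h powr (2 * r)" using assms by (simp add: powr_power mult.commute)
  then show ?thesis using assms by (simp add: powr_add)
qed

text \<open>The equation for \<open>h\<close> says that
  \<open>(h powr r)\<^sup>2 = ln n / (n * h)\<close>, so bias and noise for blocks of length
  \<open>h\<close> are of the same order.\<close>

lemma minimax_risk_le:
  assumes r: "1 < r" "r \<le> 2" and "L > 0" and "\<sigma> > 0"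
    and h: "0 < h" "h \<le> 1 / 4" "1 \<le> real n * h" and ln: "1 \<le> ln (real n)"
    and hn: "real n * h powr (2 * r + 1) = ln (real n)"
  shows "minimax_risk r L \<sigma> n \<le> ennreal ((216 * L + 20 * \<sigma>) * h powr r)"
proof -
  \<comment> \<open>Rounding up costs at most a factor 2 because \<open>1 \<le> n * h\<close>, and
    \<open>h \<le> 1 / 4\<close> then leaves room for two blocks. In the bias this factor becomes at
    most \<open>2 powr 2\<close>, whence 216 = 4 * 54.\<close>
  define K where "K = nat \<lceil>real n * h\<rceil>"
  have n: "n > 0" using h by (cases n) auto
  have K1: "real n * h \<le> K" "real K \<le> 2 * (real n * h)" using h(3) unfolding K_def by linarith+
  have K: "K > 0" using K1 h by (cases K) auto
  have "real n * h \<le> real n * (1 / 4)" using h by (intro mult_left_mono) auto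
  with K1 have "2 * real K \<le> real n" by linarith
  then have K2: "2 * K \<le> n" by linarith
  have bias: "(real K / real n) powr r \<le> 4 * h powr r"
  proof -
    have "(real K / real n) powr r \<le> (2 * h) powr r"
      using K1 n r h by (intro powr_mono2) (auto simp: pos_divide_le_eq mult_ac)
    also have "\<dots> = 2 powr r * h powr r" using h by (simp add: powr_mult)
    also have "(2::real) powr r \<le> 2 powr 2" using r by (intro powr_mono) auto
    finally show ?thesis by (simp add: mult_right_mono)
  qed
  have noise: "sqrt (ln (real n) / K) \<le> h powr r"
  proof (rule real_le_lsqrt)
    have "ln (real n) / K \<le> ln (real n) / (real n * h)"
      using K1 ln h n by (intro divide_left_mono) auto
    also have "\<dots> = (h powr r)\<^sup>2"
      using h n by (simp add: hn[symmetric] powr_double_plus_1)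
    finally show "ln (real n) / K \<le> (h powr r)\<^sup>2" .
  qed simp
  have "minimax_risk r L \<sigma> n
      \<le> (SUP f\<in>convex_holder_class r L. sup_risk n \<sigma> (block_estimator n K) f)"
    unfolding minimax_risk_def by (rule INF_lower[OF block_estimator_estimators[OF K K2]])
  also have "\<dots> \<le> ennreal ((216 * L + 20 * \<sigma>) * h powr r)"
  proof (rule SUP_least)
    fix f assume "f \<in> convex_holder_class r L"
    then have "f \<in> holder_class r L" by (simp add: convex_holder_class_def)
    then have "sup_risk n \<sigma> (block_estimator n K) f
        \<le> ennreal (54 * L * (real K / real n) powr r + 20 * \<sigma> * sqrt (ln (real n) / K))"
      using assms K K2 by (intro block_estimator_risk) auto
    also have "\<dots> \<le> ennreal (54 * L * (4 * h powr r) + 20 * \<sigma> * h powr r)"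
      using bias noise \<open>L > 0\<close> \<open>\<sigma> > 0\<close> by (intro ennreal_leI add_mono mult_left_mono) auto
    also have "54 * L * (4 * h powr r) + 20 * \<sigma> * h powr r = (216 * L + 20 * \<sigma>) * h powr r"
      by (simp add: algebra_simps)
    finally show "sup_risk n \<sigma> (block_estimator n K) f \<le> ennreal ((216 * L + 20 * \<sigma>) * h powr r)" .
  qed
  finally show ?thesis .
qed

text \<open>With slope steps \<open>c * h powr (r - 1)\<close> the distance bound becomes
  \<open>c\<^sup>2 / (2 * \<sigma>\<^sup>2) * ln n\<close>, whose exponential is a power of
  \<open>n\<close>. The 64 combines the bump height 1/16 with the factor 1/4 of the risk
  bound.\<close>

lemma minimax_risk_ge:
  assumes r: "1 < r" "r \<le> 2" and "\<sigma> > 0" and c: "0 < c" "5 * c \<le> L"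
    and h: "0 < h" "h \<le> 1" "1 \<le> real n * h"
    and hn: "real n * h powr (2 * r + 1) = ln (real n)"
    and M: "16 * real n powr (c\<^sup>2 / (2 * \<sigma>\<^sup>2)) + 1 \<le> h powr (1 - r)"
  shows "ennreal (c / 64 * h powr r) \<le> minimax_risk r L \<sigma> n"
proof -
  \<comment> \<open>As many climbs as the slope budget allows; the \<open>+ 1\<close> in the
    assumption on \<open>h\<close> absorbs the rounding down.\<close>
  define M where "M = nat \<lfloor>h powr (1 - r)\<rfloor>"
  define \<delta> where "\<delta> = c * h powr (r - 1)"
  define v where "v = c\<^sup>2 / (2 * \<sigma>\<^sup>2) * ln (real n)"
  have n: "n > 0" using h by (cases n) auto
  have \<delta>: "\<delta> > 0" using c h by (simp add: \<delta>_def)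
  have "exp v = real n powr (c\<^sup>2 / (2 * \<sigma>\<^sup>2))" using n by (simp add: v_def powr_def)
  with M have Mv: "16 * exp v \<le> real M" unfolding M_def by linarith
  have M0: "M > 0" using Mv exp_gt_zero[of v] by (cases M) auto
  have "real M \<le> h powr (1 - r)" unfolding M_def by simp
  then have "real M * h powr (r - 1) \<le> h powr (1 - r) * h powr (r - 1)" by (intro mult_right_mono) auto
  also have "\<dots> = 1" using h by (simp add: powr_add[symmetric])
  finally have Mh: "real M * h powr (r - 1) \<le> 1" .
  have "h powr 1 \<le> h powr (r - 1)" using h r by (intro powr_mono') auto
  then have "real M * h \<le> real M * h powr (r - 1)" using h by (intro mult_left_mono) auto
  with Mh have Mh1: "real M * h \<le> 1" by (rule order_trans[rotated])
  have \<psi>: "\<delta> * h = c * h powr r" using h powr_add[of h "r - 1" 1] by (simp add: \<delta>_def)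
  have dist: "n * h ^ 3 * \<delta>\<^sup>2 / (2 * \<sigma>\<^sup>2) = v"
  proof -
    have "h ^ 3 * \<delta>\<^sup>2 = (\<delta> * h)\<^sup>2 * h" by (simp add: power2_eq_square power3_eq_cube)
    also have "\<dots> = c\<^sup>2 * h powr (2 * r + 1)"
      unfolding \<psi> using h by (simp add: powr_double_plus_1 power_mult_distrib)
    finally show ?thesis by (simp add: v_def hn[symmetric])
  qed
  have "ennreal (\<delta> * h / 16 / 4) \<le> (SUP f\<in>convex_holder_class r L. sup_risk n \<sigma> fhat f)"
    if fhat: "fhat \<in> estimators n (convex_holder_class r L)" for fhat
  proof (rule sup_risk_lower_bound[OF fhat \<open>\<sigma> > 0\<close>, where g = "hypothesis M h \<delta>"
        and f = "hypothesis M h \<delta> M" and v = v and M = M])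
    show "hypothesis M h \<delta> j \<in> convex_holder_class r L" for j
      unfolding \<delta>_def using r h M0 Mh c by (intro hypothesis_in_class) auto
    show "\<exists>x\<in>{0..1}. \<delta> * h / 16 \<le> \<bar>hypothesis M h \<delta> j x - hypothesis M h \<delta> k x\<bar>"
      if "j < M" "k < M" "j \<noteq> k" for j k
      using that h Mh1 \<delta> by (intro hypothesis_separated) auto
    show "(\<Sum>i\<in>{1..n}. ((hypothesis M h \<delta> j (real i / real n) -
        hypothesis M h \<delta> M (real i / real n)) / \<sigma>)\<^sup>2) \<le> v" if "j < M" for j
      using hypothesis_distance[OF that h(1,3) \<open>\<sigma> > 0\<close>, of \<delta>] by (simp only: dist)
  qed (use \<delta> h Mv in auto)
  then show ?thesis unfolding minimax_risk_def \<psi> by (intro INF_greatest) simp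
qed

theorem theorem2p1:
  fixes r L \<sigma> :: real
  assumes "1 < r" and "r \<le> 2" and "L > 0" and "\<sigma> > 0"
  shows "\<exists>C0 :: real. C0 > 0 \<and>
    minimax_risk r L \<sigma> \<asymp>
      (\<lambda>n. ennreal (C0 * (ln (real n) / real n) powr (r / (2 * r + 1))))"
proof -
  define e where "e = 1 / (2 * r + 1)"
  define \<beta> where "\<beta> = (r - 1) * e"
  define h where "h n = (ln (real n) / real n) powr e" for n :: nat
  \<comment> \<open>The first argument keeps \<open>5 * c \<le> L\<close>. The second makes the
    second moment of the likelihood ratios at most \<open>n powr (\<beta> / 2)\<close>, which the
    number of climbs, of order \<open>(n / ln n) powr \<beta>\<close>, eventually exceeds by any
    factor.\<close>
  define c where "c = min (L / 5) (\<sigma> * sqrt \<beta>)"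
  define C where "C = 216 * L + 20 * \<sigma>"
  have e: "0 < e" "e < 1" using assms by (auto simp: e_def)
  have \<beta>: "0 < \<beta>" using assms e by (simp add: \<beta>_def)
  have c: "0 < c" "5 * c \<le> L" using assms \<beta> by (auto simp: c_def)
  have C: "0 < C" using assms by (simp add: C_def)
  have "c\<^sup>2 \<le> (\<sigma> * sqrt \<beta>)\<^sup>2" using c by (intro power_mono) (auto simp: c_def)
  then have c\<beta>: "c\<^sup>2 / (2 * \<sigma>\<^sup>2) \<le> \<beta> / 2"
    using assms \<beta> by (simp add: power_mult_distrib pos_divide_le_eq mult_ac)
  have hr: "h n powr r = (ln (real n) / real n) powr (r / (2 * r + 1))" for n
    by (simp add: h_def powr_powr e_def)
  have "\<forall>\<^sub>F n in sequentially. 1 \<le> ln (real n)" by real_asymp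
  moreover have "\<forall>\<^sub>F n in sequentially. h n \<le> 1 / 4" unfolding h_def using e by real_asymp
  moreover have "\<forall>\<^sub>F n in sequentially. 1 \<le> real n * h n" unfolding h_def using e by real_asymp
  moreover have "\<forall>\<^sub>F n in sequentially. 16 * real n powr (\<beta> / 2) + 1 \<le> (ln (real n) / real n) powr (- \<beta>)"
    using \<beta> by real_asymp
  ultimately have "\<forall>\<^sub>F n in sequentially.
      ennreal (c / 64) \<le> minimax_risk r L \<sigma> n / ennreal (1 * (ln (real n) / real n) powr (r / (2 * r + 1))) \<and>
      minimax_risk r L \<sigma> n / ennreal (1 * (ln (real n) / real n) powr (r / (2 * r + 1))) \<le> ennreal C"
  proof eventually_elim
    case (elim n)
    have n: "n > 0" using elim(3) by (cases n) auto
    have n1: "1 \<le> real n" using n by simp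
    have pos: "0 < ln (real n) / real n" using elim(1) n by (intro divide_pos_pos) (linarith, simp)
    then have h: "0 < h n" unfolding h_def by (metis powr_gt_zero less_irrefl)
    have "e * (2 * r + 1) = 1" using assms by (simp add: e_def)
    then have "h n powr (2 * r + 1) = ln (real n) / real n"
      using pos by (simp only: h_def powr_powr powr_one less_imp_le)
    then have hn: "real n * h n powr (2 * r + 1) = ln (real n)" using n by simp
    have "h n powr (1 - r) = (ln (real n) / real n) powr (- \<beta>)"
      by (simp add: h_def powr_powr \<beta>_def algebra_simps)
    moreover have "real n powr (c\<^sup>2 / (2 * \<sigma>\<^sup>2)) \<le> real n powr (\<beta> / 2)"
      using c\<beta> n1 by (rule powr_mono)
    ultimately have M: "16 * real n powr (c\<^sup>2 / (2 * \<sigma>\<^sup>2)) + 1 \<le> h n powr (1 - r)"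
      using elim(4) by linarith
    have div: "ennreal (a * h n powr r) / ennreal (h n powr r) = ennreal a" if "0 \<le> a" for a
      using that h by (subst divide_ennreal) auto
    have "ennreal (c / 64 * h n powr r) \<le> minimax_risk r L \<sigma> n"
      using assms c h elim(2,3) hn M by (intro minimax_risk_ge) auto
    moreover have "minimax_risk r L \<sigma> n \<le> ennreal (C * h n powr r)"
      unfolding C_def using assms h elim hn by (intro minimax_risk_le) auto
    ultimately show ?case
      using divide_right_mono_ennreal[of "ennreal (c / 64 * h n powr r)" "minimax_risk r L \<sigma> n" "ennreal (h n powr r)"]
        divide_right_mono_ennreal[of "minimax_risk r L \<sigma> n" "ennreal (C * h n powr r)" "ennreal (h n powr r)"]
        div[of "c / 64"] div[of C] c C
      by (simp add: hr[symmetric])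
  qed
  \<comment> \<open>The relation \<open>\<asymp>\<close> absorbs the constants of both bounds, so
    \<open>C0 = 1\<close> serves.\<close>
  then show ?thesis
    unfolding same_order_def using c C
    by (intro exI[of _ 1] conjI exI[of _ "c / 64"] exI[of _ C]) auto
qed

end
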